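(* Let $\tau=(1+\sqrt5)/2$ and $\theta=(3\tau+1)/2$. Let $V:\mathbb{R}\to\mathbb{R}$ be the potential generated by the Fibonacci chain $S$ (defined in the context), and let $H(\xi,\eta)=\frac12(\xi-\eta)^2+V(\xi)$. Then: (i) there exists a minimal configuration (with respect to $H$) with rotation number $\theta$; (ii) there exists an equilibrium configuration (with respect to $H$) with rotation number $\theta$ that is not minimal.
   Context: Fibonacci chain. Let $\tau=(1+\sqrt5)/2$. Let $\rho$ be the substitution $a\mapsto ab$, $b\mapsto a$ on words in $\{a,b\}$; put $u^{(1)}=a$, $u^{(i+1)}=\rho(u^{(i)})$, and let $u=u_0u_1u_2\cdots=abaababa\cdots$ be the infinite word that is the limit of the $u^{(i)}$. Let $w=(w_j)_{j\in\mathbb{Z}}$ be the bi-infinite word with $w_j=u_j$ for $j\ge0$, $w_{-1}=a$, $w_{-2}=b$, and $w_{-3-k}=u_k$ for $k\ge 0$. Put $|a|=\tau$, $|b|=1$, $S_0=0$ and $S_i=S_{i-1}+|w_{i-1}|$ for all $i\in\mathbb{Z}$. The Fibonacci chain is $S=\{S_i: i\in\mathbb{Z}\}\subset\mathbb{R}$. Potential. For $x\ge 0$ let $\alpha(x)=\max\{y\in S: y\le x\}$ and $\beta(x)=\min\{y\in S: y>x\}$. For $-\tau^2\le x<0$ let $\alpha(x)=-\beta(-x)$ and $\beta(x)=-\alpha(-x)$; for $x<-\tau^2$ let $\alpha(x)=-\beta(-x-\tau^2)-\tau^2$ and $\beta(x)=-\alpha(-x-\tau^2)-\tau^2$. Let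 $\zeta:\mathbb{R}\to\mathbb{R}$ be $\zeta(x)=-64x^2+\frac{160}{27}$ for $|x|\le\frac14$, $\zeta(x)=\frac{64}{27}(3|x|-1)^2(96|x|-11)$ for $\frac14<|x|<\frac13$, and $\zeta(x)=0$ otherwise. Define $V(x)=\zeta(x-\alpha(x))$ if $2x\le\alpha(x)+\beta(x)$, and $V(x)=\zeta(x-\beta(x))$ if $2x>\alpha(x)+\beta(x)$. ($V$ is $C^1$.) Configurations. A configuration is an element $x=(x_i)_{i\in\mathbb{Z}}\in\mathbb{R}^{\mathbb{Z}}$. For $j<k$ put $H(x_j,\dots,x_k)=\sum_{i=j}^{k-1}H(x_i,x_{i+1})$. The segment $(x_j,\dots,x_k)$ is minimal if $H(x_j,\dots,x_k)\le H(x_j^*,\dots,x_k^* )$ for all $(x_j^*,\dots,x_k^* )$ with $x_j^*=x_j$ and $x_k^*=x_k$. The configuration $x$ is minimal if all its finite segments are minimal. It is an equilibrium (stationary) configuration if $\partial_2H(x_{i-1},x_i)+\partial_1H(x_i,x_{i+1})=0$ for all $i\in\mathbb{Z}$, i.e. $2x_i-x_{i-1}-x_{i+1}+V'(x_i)=0$ for all $i\in\mathbb{Z}$. It has rotation number $\rho\in\mathbb{R}$ if $\lim_{i\to\pm\infty}x_i/i=\rho$. *)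

theory Defs
  imports Complex_Main "HOL-Library.Sublist"
begin

definition tau :: real where
  "tau = (1 + sqrt 5) / 2"

datatype letter = A | B

fun subst_letter :: "letter \<Rightarrow> letter list" where
  "subst_letter A = [A, B]"
| "subst_letter B = [A]"

definition subst :: "letter list \<Rightarrow> letter list" where
  "subst v = concat (map subst_letter v)"

(* u_fin i is the word u^(i), with indices starting at 1: u_fin 1 = a; the value at 0 is unused. *)
definition u_fin :: "nat \<Rightarrow> letter list" where
  "u_fin i = (subst ^^ (i - 1)) [A]"

(* The words u^(i) form a chain of prefixes and u^(i) has length at least i (lemmas u_fin_prefix
   and u_fin_length below), so the k-th letter (from 0) of their limit can be read off u^(k+1). *)
definition u :: "nat \<Rightarrow> letter" where
  "u k = u_fin (k + 1) ! k"

definition w :: "int \<Rightarrow> letter" where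
  "w j = (if j \<ge> 0 then u (nat j)
          else if j = -1 then A
          else if j = -2 then B
          else u (nat (-3 - j)))"

fun len :: "letter \<Rightarrow> real" where
  "len A = tau"
| "len B = 1"

(* The two-sided recursion S_i = S_(i-1) + |w_(i-1)| with S_0 = 0, solved explicitly;
   see lemmas S_0 and S_rec. *)
definition S :: "int \<Rightarrow> real" where
  "S i = (if i \<ge> 0 then (\<Sum>j\<in>{0..<i}. len (w j)) else - (\<Sum>j\<in>{i..<0}. len (w j)))"

definition fib_chain :: "real set" where
  "fib_chain = range S"

definition alpha_nonneg :: "real \<Rightarrow> real" where
  "alpha_nonneg x = (GREATEST y. y \<in> fib_chain \<and> y \<le> x)"

definition beta_nonneg :: "real \<Rightarrow> real" where
  "beta_nonneg x = (LEAST y. y \<in> fib_chain \<and> y > x)"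

definition alpha :: "real \<Rightarrow> real" where
  "alpha x = (if x \<ge> 0 then alpha_nonneg x
              else if x \<ge> - tau\<^sup>2 then - beta_nonneg (- x)
              else - beta_nonneg (- x - tau\<^sup>2) - tau\<^sup>2)"

definition beta :: "real \<Rightarrow> real" where
  "beta x = (if x \<ge> 0 then beta_nonneg x
             else if x \<ge> - tau\<^sup>2 then - alpha_nonneg (- x)
             else - alpha_nonneg (- x - tau\<^sup>2) - tau\<^sup>2)"

definition zeta :: "real \<Rightarrow> real" where
  "zeta x = (if \<bar>x\<bar> \<le> 1/4 then -64 * x\<^sup>2 + 160/27
             else if \<bar>x\<bar> < 1/3 then 64/27 * (3 * \<bar>x\<bar> - 1)\<^sup>2 * (96 * \<bar>x\<bar> - 11)
             else 0)"

definition V :: "real \<Rightarrow> real" where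
  "V x = (if 2 * x \<le> alpha x + beta x then zeta (x - alpha x) else zeta (x - beta x))"

definition H :: "real \<Rightarrow> real \<Rightarrow> real" where
  "H \<xi> \<eta> = 1/2 * (\<xi> - \<eta>)\<^sup>2 + V \<xi>"

definition segment_energy :: "(real \<Rightarrow> real \<Rightarrow> real) \<Rightarrow> (int \<Rightarrow> real) \<Rightarrow> int \<Rightarrow> int \<Rightarrow> real" where
  "segment_energy h x j k = (\<Sum>i\<in>{j..<k}. h (x i) (x (i + 1)))"

(* A competitor is given as a whole configuration y; only y_j, ..., y_k enter. *)
definition minimal_segment :: "(real \<Rightarrow> real \<Rightarrow> real) \<Rightarrow> (int \<Rightarrow> real) \<Rightarrow> int \<Rightarrow> int \<Rightarrow> bool" where
  "minimal_segment h x j k \<longleftrightarrow>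
     (\<forall>y. y j = x j \<and> y k = x k \<longrightarrow> segment_energy h x j k \<le> segment_energy h y j k)"

definition minimal_configuration :: "(real \<Rightarrow> real \<Rightarrow> real) \<Rightarrow> (int \<Rightarrow> real) \<Rightarrow> bool" where
  "minimal_configuration h x \<longleftrightarrow> (\<forall>j k. j < k \<longrightarrow> minimal_segment h x j k)"

(* d2 and d1 are the partial derivatives of h in the second argument at (x_(i-1), x_i) and in the
   first argument at (x_i, x_(i+1)); their existence is part of the definition. *)
definition equilibrium_configuration :: "(real \<Rightarrow> real \<Rightarrow> real) \<Rightarrow> (int \<Rightarrow> real) \<Rightarrow> bool" where
  "equilibrium_configuration h x \<longleftrightarrow>
     (\<forall>i. \<exists>d2 d1.
        ((\<lambda>\<eta>. h (x (i - 1)) \<eta>) has_real_derivative d2) (at (x i)) \<and>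
        ((\<lambda>\<xi>. h \<xi> (x (i + 1))) has_real_derivative d1) (at (x i)) \<and>
        d2 + d1 = 0)"

definition has_rotation_number :: "(int \<Rightarrow> real) \<Rightarrow> real \<Rightarrow> bool" where
  "has_rotation_number x r \<longleftrightarrow>
     ((\<lambda>i. x i / of_int i) \<longlongrightarrow> r) at_top \<and> ((\<lambda>i. x i / of_int i) \<longlongrightarrow> r) at_bot"

lemma u_fin_1: "u_fin 1 = [A]"
  by (simp add: u_fin_def)

lemma u_fin_Suc: "i \<ge> 1 \<Longrightarrow> u_fin (i + 1) = subst (u_fin i)"
  by (cases i) (simp_all add: u_fin_def)

lemma subst_append: "subst (v @ v') = subst v @ subst v'"
  by (simp add: subst_def)

lemma u_fin_prefix_Suc: "i \<ge> 1 \<Longrightarrow> prefix (u_fin i) (u_fin (i + 1))"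
proof (induction i rule: nat_induct_at_least)
  case base
  show ?case by (simp add: u_fin_def subst_def)
next
  case (Suc i)
  then show ?case
    by (metis u_fin_Suc Suc_eq_plus1 le_SucI prefix_def subst_append)
qed

lemma u_fin_prefix:
  assumes "1 \<le> i" "i \<le> j"
  shows "prefix (u_fin i) (u_fin j)"
  using assms(2,1)
proof (induction j rule: dec_induct)
  case base
  show ?case by simp
next
  case (step n)
  then show ?case
    using u_fin_prefix_Suc[of n] by (auto intro: prefix_order.trans)
qed

lemma length_subst: "length v \<le> length (subst v)"
proof (induction v)
  case (Cons c v)
  then show ?case by (cases c) (simp_all add: subst_def)
qed (simp add: subst_def)

lemma u_fin_starts_A: "i \<ge> 1 \<Longrightarrow> \<exists>v. u_fin i = A # v"
  using u_fin_prefix[of 1 i] by (auto simp: u_fin_1[simplified] prefix_def)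

lemma u_fin_length: "i \<ge> 1 \<Longrightarrow> i \<le> length (u_fin i)"
proof (induction i rule: nat_induct_at_least)
  case base
  show ?case by (simp add: u_fin_def)
next
  case (Suc i)
  obtain v where v: "u_fin i = A # v"
    using u_fin_starts_A Suc.hyps by blast
  have "u_fin (Suc i) = [A, B] @ subst v"
    using u_fin_Suc[of i] Suc.hyps v by (simp add: subst_def)
  then show ?case
    using Suc.IH v length_subst[of v] by simp
qed

lemma u_eq_u_fin:
  assumes "i \<ge> 1" "k < length (u_fin i)"
  shows "u k = u_fin i ! k"
proof (cases "i \<le> k + 1")
  case True
  then show ?thesis
    using u_fin_prefix[of i "k + 1"] assms by (auto simp: u_def prefix_def nth_append)
next
  case False
  then show ?thesis
    using u_fin_prefix[of "k + 1" i] u_fin_length[of "k + 1"]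
    by (auto simp: u_def prefix_def nth_append)
qed

lemma S_0: "S 0 = 0"
  by (simp add: S_def)

lemma S_rec: "S i = S (i - 1) + len (w (i - 1))"
proof (cases "i \<ge> 1")
  case True
  then have "{0..<i} = insert (i - 1) {0..<i - 1}" by auto
  with True show ?thesis by (simp add: S_def)
next
  case False
  then have "{i - 1..<0} = insert (i - 1) {i..<0}" by auto
  with False show ?thesis by (auto simp: S_def)
qed

end

(*
The potential V is zeta centred at the points of S.

(i) On the windows [-tau^(2m+1), tau^(2m+1)], tiled by the word rho^(2m)(aa), take an energy-minimal
chain with about 2 tau^(2m+1) / theta bonds, both ends pinned on peaks of V.  If two translated copies
of one patch contained numbers of atoms differing by more than 3, parts of the chain in the two copies
could be interchanged without increasing the energy; when the energy stays the same, the new chain is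
minimal as well but violates the stationarity equation at an atom where the two pieces meet.  Hence all
blocks rho^n(a), and likewise all blocks rho^n(b), carry the same number of atoms up to 3, and as the
letter frequencies in a Fibonacci word converge with bounded discrepancy, the density of atoms is
1 / theta up to a relative error O(tau^-n), uniformly in m.  Recentre the chains at 0; by compactness a
subsequence converges, the limit is minimal, and letting n tend to infinity gives its rotation number.

(ii) Let s_i be the last point of S before i theta.  Near the peaks the stationarity equation for
x_i = s_i + t_i is linear, 126 t_i + t_(i-1) + t_(i+1) = 2 s_i - s_(i-1) - s_(i+1), with a unique
bounded solution, small enough for every x_i to stay in the quadratic region around s_i.  The energy is
strictly concave in each single atom, so this equilibrium is not minimal.
*)
theory Submission
  imports Defs "HOL-Analysis.Analysis"
begin

section \<open>The potential and its bumps\<close>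

text \<open>Pinning the ends and the number of atoms prescribes only the mean density of a finite
  chain; the obstacle is that atoms might bunch together as the windows grow. \<open>V\<close> is
  not periodic, so a translated chain is no competitor, and only repeated patches can be compared.
  Two copies of a patch can be cut where a bond of one copy, translated, lies inside a bond of the
  other. Exchanging what lies between two such cuts keeps the total number of atoms, although the
  two pieces may carry different numbers, and changes the elastic energy by two products of factors
  of equal sign. An excess of 4 atoms forces two such nested pairs of bonds. There are only two
  kinds of blocks, so equal counts in blocks of each kind, up to 3, tie the density of every long
  part of the window to the prescribed mean density. Even powers of the substitution appear because
  the left half of the chain is a mirror image that ends in BA: \<open>(subst ^^ n) [A]\<close> is a
  palindrome followed by BA for even positive n, and by AB for odd n. The ends are pinned on peaks
  so that no atoms can coincide there.\<close>

lemma tau_pos: "tau > 0" and tau_sq: "tau\<^sup>2 = tau + 1" and tau_bounds: "1.6 < tau" "tau < 1.65"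
proof -
  have "sqrt 5 > 2.2" by (rule real_less_rsqrt) (simp add: power2_eq_square)
  moreover have "sqrt 5 < 2.3" by (rule real_less_lsqrt) (simp_all add: power2_eq_square)
  ultimately show "tau > 0" "1.6 < tau" "tau < 1.65" by (simp_all add: tau_def)
  show "tau\<^sup>2 = tau + 1" by (simp add: tau_def power2_eq_square field_simps)
qed

section \<open>Spacing and symmetry of the points of the chain\<close>

lemma len_ge_1: "1 \<le> len c" and len_le_2: "len c \<le> 2"
  using tau_bounds by (cases c; simp)+

lemma S_succ: "S (i + 1) = S i + len (w i)"
  using S_rec[of "i + 1"] by simp

lemma S_diff_ge: "S (i + int k) \<ge> S i + real k"
proof (induction k)
  case (Suc k)
  have "S (i + int (Suc k)) = S (i + int k) + len (w (i + int k))"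
    using S_succ[of "i + int k"] by (simp add: algebra_simps)
  then show ?case using Suc len_ge_1[of "w (i + int k)"] by simp
qed simp

lemma S_gap: "i \<le> j \<Longrightarrow> S i + real_of_int (j - i) \<le> S j"
  using S_diff_ge[of i "nat (j - i)"] by simp

lemma S_le_iff: "S i \<le> S j \<longleftrightarrow> i \<le> j"
  using S_gap[of i j] S_gap[of "j + 1" i] S_gap[of j i]
  by (cases "i \<le> j") auto

lemma S_cover: "\<exists>i. S i \<le> x \<and> x < S (i + 1)"
proof -
  have ge: "of_int i \<le> S i" if "0 \<le> i" for i using S_gap[of 0 i] that by (simp add: S_0)
  have le: "S i \<le> of_int i" if "i \<le> 0" for i using S_gap[of i 0] that by (simp add: S_0)
  define I where "I = {i. S i \<le> x}"
  have bdd: "i \<le> max 0 \<lfloor>x\<rfloor>" if "i \<in> I" for i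
    using that ge[of i] by (cases "i \<ge> 0") (auto simp: I_def le_floor_iff)
  have ne: "min 0 \<lfloor>x\<rfloor> \<in> I"
  proof -
    have "of_int (min 0 \<lfloor>x\<rfloor>) \<le> x" by linarith
    with le[of "min 0 \<lfloor>x\<rfloor>"] show ?thesis by (simp add: I_def)
  qed
  define J where "J = I \<inter> {min 0 \<lfloor>x\<rfloor>..max 0 \<lfloor>x\<rfloor>}"
  have fin: "finite J" and "J \<noteq> {}" using ne by (auto simp: J_def)
  then have "Max J \<in> J" by simp
  moreover have "\<not> Max J + 1 \<in> I"
  proof
    assume "Max J + 1 \<in> I"
    with bdd[OF this] \<open>Max J \<in> J\<close> have "Max J + 1 \<in> J" by (auto simp: J_def)
    then show False using Max_ge[OF fin] by fastforce
  qed
  ultimately show ?thesis by (auto simp: J_def I_def)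
qed

lemma alpha_nonneg_eq: "S i \<le> x \<Longrightarrow> x < S (i + 1) \<Longrightarrow> alpha_nonneg x = S i"
  unfolding alpha_nonneg_def fib_chain_def
  by (rule Greatest_equality) (auto simp: S_le_iff, metis S_le_iff linorder_not_le order_le_less_trans zle_add1_eq_le)

lemma beta_nonneg_eq: "S i \<le> x \<Longrightarrow> x < S (i + 1) \<Longrightarrow> beta_nonneg x = S (i + 1)"
  unfolding beta_nonneg_def fib_chain_def
  by (rule Least_equality) (auto simp: S_le_iff, metis S_le_iff add1_zle_eq linorder_not_le order_less_le_trans)

lemma u_0: "u 0 = A" and u_1: "u 1 = B" and u_2: "u 2 = A"
  by (simp_all add: u_def u_fin_def subst_def numeral_2_eq_2)

text \<open>The letters at -1 and -2 have total length \<open>tau\<^sup>2\<close>, and beyond them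
  the left half repeats the right half in reverse. So the right half is carried to the left one by
  the reflection at \<open>- tau\<^sup>2 / 2\<close>.\<close>

lemma S_neg: "S (- 2 - int k) = - tau\<^sup>2 - S (int k)"
proof (induction k)
  case 0
  then show ?case using S_rec[of 0] S_rec[of "-1"] by (simp add: S_0 w_def tau_sq)
next
  case (Suc k)
  have "S (- 2 - int (Suc k)) = S (- 2 - int k) - len (w (- 2 - int (Suc k)))"
    using S_rec[of "- 2 - int k"] by (simp add: algebra_simps)
  moreover have "w (- 2 - int (Suc k)) = u k" by (simp add: w_def)
  moreover have "S (int (Suc k)) = S (int k) + len (u k)"
    using S_succ[of "int k"] by (simp add: w_def algebra_simps)
  ultimately show ?case using Suc by simp
qed

lemma S_small: "S 1 = tau" "S 2 = tau\<^sup>2" "S 3 = tau\<^sup>2 + tau" "S (-1) = - tau" "S (-2) = - tau\<^sup>2"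
  "S (-3) = - tau\<^sup>2 - tau"
proof -
  show "S 1 = tau" using S_succ[of 0] by (simp add: S_0 w_def u_0)
  then show "S 2 = tau\<^sup>2" using S_succ[of 1] u_1 by (simp add: w_def tau_sq)
  then show "S 3 = tau\<^sup>2 + tau" using S_succ[of 2] by (simp add: w_def u_2)
  show "S (-1) = - tau" using S_rec[of 0] by (simp add: S_0 w_def)
  show "S (-2) = - tau\<^sup>2" using S_neg[of 0] by (simp add: S_0)
  show "S (-3) = - tau\<^sup>2 - tau" using S_neg[of 1] \<open>S 1 = tau\<close> by simp
qed

text \<open>The reflections used by \<open>alpha\<close> and \<open>beta\<close> on the negative
  side carry the relevant points of the chain to points of the chain: by \<open>S_neg\<close> far
  from 0, by inspection near 0. The right inequality is weak because \<open>beta x = x\<close> at a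
  negative point of the chain.\<close>

lemma alpha_beta: "\<exists>i. S i \<le> x \<and> x \<le> S (i + 1) \<and> alpha x = S i \<and> beta x = S (i + 1)"
proof -
  consider "x \<ge> 0" | "- tau\<^sup>2 \<le> x" "x < 0" | "x < - tau\<^sup>2" by linarith
  then show ?thesis
  proof cases
    case 1
    obtain i where "S i \<le> x" "x < S (i + 1)" using S_cover by blast
    with 1 show ?thesis
      by (intro exI[of _ i]) (simp add: alpha_def beta_def alpha_nonneg_eq beta_nonneg_eq)
  next
    case 2
    obtain i where i: "S i \<le> - x" "- x < S (i + 1)" using S_cover by blast
    have "S 0 < S (i + 1)" "S i < S 3" using i 2 tau_pos by (auto simp: S_0 S_small)
    \<comment> \<open>The index 2 occurs only when \<open>- x\<close> is the point
      \<open>S 2\<close>.\<close>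
    then have "i = 0 \<or> i = 1 \<or> i = 2" using S_le_iff[of "i+1" 0] S_le_iff[of 3 i] by auto
    then have "- S i = S (- i)" "- S (i + 1) = S (- i - 1)" by (auto simp: S_0 S_small)
    with i 2 show ?thesis
      by (intro exI[of _ "- i - 1"]) (simp add: alpha_def beta_def alpha_nonneg_eq beta_nonneg_eq)
  next
    case 3
    obtain i where i: "S i \<le> - x - tau\<^sup>2" "- x - tau\<^sup>2 < S (i + 1)" using S_cover by blast
    have "S 0 < S (i + 1)" using i 3 by (simp add: S_0)
    then have "i \<ge> 0" using S_le_iff[of "i+1" 0] by auto
    then have "- tau\<^sup>2 - S i = S (- 2 - i)" "- tau\<^sup>2 - S (i + 1) = S (- 3 - i)"
      using S_neg[of "nat i"] S_neg[of "nat (i + 1)"] by (auto simp: add.commute[of 1 i] diff_diff_eq2[symmetric] minus_diff_commute)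
    moreover have "\<not> x \<ge> 0" using 3 by (smt (verit) zero_le_power2)
    ultimately show ?thesis using i 3
      by (intro exI[of _ "- 3 - i"]) (simp add: alpha_def beta_def alpha_nonneg_eq beta_nonneg_eq)
  qed
qed

lemma zeta_minus: "zeta (- x) = zeta x"
  by (simp add: zeta_def)

text \<open>Points of the chain are at least 1 apart, so \<open>S i\<close> is a nearest one. In the
  tie at distance 1/2 both candidates give 0.\<close>

lemma V_near:
  assumes "\<bar>x - S i\<bar> \<le> 1/2"
  shows "V x = zeta (x - S i)"
proof -
  obtain j where j: "S j \<le> x" "x \<le> S (j + 1)" "alpha x = S j" "beta x = S (j + 1)"
    using alpha_beta by blast
  have gap: "S j + 1 \<le> S (j + 1)" using S_gap[of j "j+1"] by simp
  have "\<not> i < j" using S_gap[of i j] assms j by (auto simp: abs_le_iff)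
  moreover have "\<not> i > j + 1" using S_gap[of "j+1" i] assms j by (auto simp: abs_le_iff)
  ultimately consider "i = j" | "i = j + 1" by linarith
  then show ?thesis
  proof cases
    case 1
    then show ?thesis using assms j gap by (auto simp: V_def abs_le_iff)
  next
    case 2
    show ?thesis
    proof (cases "2 * x \<le> alpha x + beta x")
      case True
      then have "x - S j = 1/2" "x - S i = - 1/2" using 2 assms j gap by (auto simp: abs_le_iff)
      then show ?thesis using True j by (simp add: V_def zeta_def)
    next
      case False
      then show ?thesis using 2 j by (simp add: V_def)
    qed
  qed
qed

lemma V_far: "(\<And>i. \<bar>x - S i\<bar> \<ge> 1/3) \<Longrightarrow> V x = 0"
proof -
  assume a: "\<And>i. \<bar>x - S i\<bar> \<ge> 1/3"
  obtain j where "alpha x = S j" "beta x = S (j + 1)" using alpha_beta by blast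
  then show "V x = 0" using a[of j] a[of "j+1"] by (auto simp: V_def zeta_def)
qed

lemma zeta_zero: "1/3 \<le> x \<Longrightarrow> zeta x = 0"
  by (simp add: zeta_def)

text \<open>The restriction of \<open>V\<close> to a gap of length l, in terms of the distance t
  from its left end; \<open>zeta\<close> is even, so only the distance to the nearer end
  matters.\<close>

definition gap_potential :: "real \<Rightarrow> real \<Rightarrow> real" where
  "gap_potential l t = zeta (min t (l - t))"

lemma V_gap:
  assumes "S i \<le> x" "x \<le> S (i + 1)"
  shows "V x = gap_potential (len (w i)) (x - S i)"
proof -
  have gap: "S i + 1 \<le> S (i + 1)" using S_gap[of i "i+1"] by simp
  have l: "len (w i) = S (i + 1) - S i" by (simp add: S_succ)
  consider "\<bar>x - S i\<bar> \<le> 1/3" | "\<bar>x - S (i + 1)\<bar> \<le> 1/3"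
    | "x - S i > 1/3" "S (i + 1) - x > 1/3" using assms by fastforce
  then show ?thesis
  proof cases
    case 1
    then show ?thesis using V_near[of x i] gap assms
      by (auto simp: gap_potential_def S_succ min_def)
  next
    case 2
    then show ?thesis using V_near[of x "i + 1"] zeta_minus[of "x - S (i+1)"] gap assms l
      by (auto simp: gap_potential_def min_def abs_le_iff)
  next
    case 3
    have "\<bar>x - S j\<bar> \<ge> 1/3" for j
      using 3 S_gap[of j i] S_gap[of "i+1" j] by (cases "j \<le> i") auto
    then have "V x = 0" by (rule V_far)
    moreover have "1/3 \<le> min (x - S i) (len (w i) - (x - S i))"
      using 3 S_succ[of i] by (auto simp: min_def)
    then have "gap_potential (len (w i)) (x - S i) = 0"
      unfolding gap_potential_def by (rule zeta_zero)
    ultimately show ?thesis by simp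
  qed
qed

lemma zeta_le: "zeta x \<le> zeta 0"
proof -
  have "64/27 * (3 * \<bar>x\<bar> - 1)\<^sup>2 * (96 * \<bar>x\<bar> - 11) \<le> 160/27" if "1/4 < \<bar>x\<bar>" "\<bar>x\<bar> < 1/3"
  proof -
    have "(3 * \<bar>x\<bar> - 1)\<^sup>2 \<le> (1/4)\<^sup>2"
      using that by (subst abs_le_square_iff[symmetric]) auto
    then have "(3 * \<bar>x\<bar> - 1)\<^sup>2 * (96 * \<bar>x\<bar> - 11) \<le> (1/4)\<^sup>2 * 21"
      using that by (intro mult_mono) auto
    then show ?thesis by (simp add: power2_eq_square)
  qed
  then show ?thesis by (auto simp: zeta_def)
qed

lemma V_le: "V x \<le> zeta 0"
  by (auto simp: V_def zeta_le)

lemma V_S: "V (S i) = zeta 0"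
  using V_near[of "S i" i] by simp

section \<open>Differentiability of the potential\<close>

lemma has_real_derivative_left_right:
  fixes f :: "real \<Rightarrow> real"
  assumes "(p has_real_derivative d) (at x)" "(q has_real_derivative d) (at x)"
    and "p x = f x" "q x = f x" "e > 0"
    and "\<And>y. x - e < y \<Longrightarrow> y < x \<Longrightarrow> f y = p y" "\<And>y. x < y \<Longrightarrow> y < x + e \<Longrightarrow> f y = q y"
  shows "(f has_real_derivative d) (at x)"
proof -
  have "((\<lambda>y. (p y - p x) / (y - x)) \<longlongrightarrow> d) (at_left x)" "((\<lambda>y. (q y - q x) / (y - x)) \<longlongrightarrow> d) (at_right x)"
    using assms(1,2) by (auto simp: has_field_derivative_iff filterlim_at_split)
  moreover have "eventually (\<lambda>y. (p y - p x) / (y - x) = (f y - f x) / (y - x)) (at_left x)"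
    unfolding eventually_at_left_field using assms by (intro exI[of _ "x - e"]) auto
  moreover have "eventually (\<lambda>y. (q y - q x) / (y - x) = (f y - f x) / (y - x)) (at_right x)"
    unfolding eventually_at_right_field using assms by (intro exI[of _ "x + e"]) auto
  ultimately show ?thesis
    by (auto simp: has_field_derivative_iff filterlim_at_split elim: Lim_transform_eventually)
qed

text \<open>The two polynomial pieces share value and slope -32 at 1/4, and the second has a double
  zero at 1/3.\<close>

lemma zeta_differentiable: "\<exists>d. (zeta has_real_derivative d) (at x)"
proof -
  define p where "p x = -64 * x\<^sup>2 + 160/27" for x :: real
  define q where "q x = 64/27 * (3 * x - 1)\<^sup>2 * (96 * x - 11)" for x :: real
  have p': "(p has_real_derivative (- 128 * x)) (at x)" for x
    unfolding p_def by (auto intro!: derivative_eq_intros)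
  have q': "(q has_real_derivative
      64/27 * (6 * (3 * x - 1) * (96 * x - 11) + 96 * (3 * x - 1)\<^sup>2)) (at x)" for x
    unfolding q_def by (auto intro!: derivative_eq_intros simp: power2_eq_square field_simps)
  have z': "((\<lambda>_. 0::real) has_real_derivative 0) (at x)" for x :: real by simp
  have nonneg: "\<exists>d. (zeta has_real_derivative d) (at x)" if "x \<ge> 0" for x
  proof -
    consider "x < 1/4" | "x = 1/4" | "1/4 < x" "x < 1/3" | "x = 1/3" | "x > 1/3" by linarith
    then show ?thesis
    proof cases
      case 1
      with that show ?thesis
        by - (rule exI, rule has_real_derivative_left_right[OF p' p', where e = "1/4 - x"], auto simp: p_def zeta_def)
    next
      case 2
      have "(q has_real_derivative (- 128 * x)) (at x)"
        using q'[of "1/4"] unfolding 2 by (simp add: power2_eq_square)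
      then show ?thesis
        by - (rule exI, rule has_real_derivative_left_right[OF p', where e = "1/12"],
          auto simp: 2 p_def q_def zeta_def power2_eq_square)
    next
      case 3
      then show ?thesis
        by - (rule exI, rule has_real_derivative_left_right[OF q' q', where e = "min (x - 1/4) (1/3 - x)"], auto simp: q_def zeta_def)
    next
      case 4
      have "(q has_real_derivative 0) (at x)"
        using q'[of "1/3"] unfolding 4 by (simp add: power2_eq_square)
      then show ?thesis
        by - (rule exI, rule has_real_derivative_left_right[where p = q, OF _ z', where e = "1/12"],
          auto simp: 4 q_def zeta_def power2_eq_square)
    next
      case 5
      then show ?thesis
        by - (rule exI, rule has_real_derivative_left_right[OF z' z', where e = "x - 1/3"], auto simp: zeta_def)
    qed
  qed
  show ?thesis
  proof (cases "x \<ge> 0")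
    case False
    then obtain d where "(zeta has_real_derivative d) (at (- x))" using nonneg[of "- x"] by auto
    then have "((\<lambda>y. zeta (- y)) has_real_derivative - d) (at x)"
      using DERIV_mirror[of zeta d x] by simp
    then show ?thesis by (auto simp: zeta_minus)
  qed (rule nonneg)
qed

lemma V_differentiable: "\<exists>d. (V has_real_derivative d) (at x)"
proof (cases "\<exists>i. \<bar>x - S i\<bar> < 1/2")
  case True
  then obtain i where i: "\<bar>x - S i\<bar> < 1/2" by blast
  obtain d where d: "(zeta has_real_derivative d) (at (x - S i))" using zeta_differentiable by blast
  have "((\<lambda>y. zeta (y - S i)) has_real_derivative d) (at x)"
    using DERIV_shift[of zeta d x "- S i"] d by simp
  moreover have "eventually (\<lambda>y. \<bar>y - S i\<bar> < 1/2) (nhds x)"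
    using i by (intro order_tendstoD(2)[of _ "\<bar>x - S i\<bar>"]) (auto intro!: tendsto_intros filterlim_ident)
  then have "eventually (\<lambda>y. V y = zeta (y - S i)) (nhds x)"
    by eventually_elim (simp add: V_near)
  ultimately show ?thesis by (metis DERIV_cong_ev)
next
  case False
  obtain i where i: "S i \<le> x" "x < S (i + 1)" using S_cover by blast
  have *: "S i + 1/2 \<le> x" "x \<le> S (i + 1) - 1/2"
    using i False[unfolded not_ex, THEN spec, of i] False[unfolded not_ex, THEN spec, of "i+1"] by auto
  \<comment> \<open>A point at distance at least 1/2 from the chain stays at distance 1/3 when moved
    by less than 1/6.\<close>
  have z: "V y = 0" if "x - 1/6 < y" "y < x + 1/6" for y
  proof (rule V_far)
    show "1/3 \<le> \<bar>y - S j\<bar>" for j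
      using * that S_gap[of j i] S_gap[of "i+1" j] by (cases "j \<le> i") auto
  qed
  have "((\<lambda>_. 0::real) has_real_derivative 0) (at x)" by simp
  from has_real_derivative_left_right[OF this this, of V "1/6"] z show ?thesis by auto
qed

definition V' :: "real \<Rightarrow> real" where
  "V' x = (SOME d. (V has_real_derivative d) (at x))"

lemma V_has_derivative: "(V has_real_derivative V' x) (at x)"
  unfolding V'_def using V_differentiable by (rule someI_ex)

lemma continuous_on_V: "continuous_on X V"
  by (intro DERIV_continuous_on[OF has_field_derivative_at_within[OF V_has_derivative]])

section \<open>Elastic energy of finite chains\<close>

fun elastic :: "real list \<Rightarrow> real" where
  "elastic [] = 0"
| "elastic [a] = 0"
| "elastic (a # b # xs) = (a - b)\<^sup>2 / 2 + elastic (b # xs)"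

text \<open>The last atom contributes to the potential term too, unlike in
  \<open>segment_energy H\<close>; with fixed ends the two differ by a constant.\<close>

definition energy :: "real list \<Rightarrow> real" where
  "energy xs = elastic xs + sum_list (map V xs)"

lemma elastic_Cons: "elastic (a # xs) = (if xs = [] then 0 else (a - hd xs)\<^sup>2 / 2 + elastic xs)"
  by (cases xs) auto

lemma elastic_append:
  "xs \<noteq> [] \<Longrightarrow> ys \<noteq> [] \<Longrightarrow> elastic (xs @ ys) = elastic xs + (last xs - hd ys)\<^sup>2 / 2 + elastic ys"
  by (induction xs) (auto simp: elastic_Cons)

lemma elastic_map_add: "elastic (map (\<lambda>x. x + c) xs) = elastic xs"
  by (induction xs rule: elastic.induct) auto

lemma elastic_rev: "elastic (rev xs) = elastic xs"
  by (induction xs) (auto simp: elastic_Cons elastic_append last_rev power2_commute)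

text \<open>Selection sort by reversals. Reversing the initial segment that ends in the minimum c
  changes only the bonds at its two ends and lowers the elastic energy by
  \<open>(z - c) * (d - a)\<close>, with z the first atom of the segment and d the atom after it.
  The rest is sorted with c as its left end.\<close>

lemma elastic_sort:
  assumes "\<And>x. x \<in> set xs \<Longrightarrow> a \<le> x" "\<And>x. x \<in> set xs \<Longrightarrow> x \<le> b" "a \<le> b"
  shows "\<exists>ys. mset ys = mset xs \<and> sorted (a # ys @ [b]) \<and> elastic (a # ys @ [b]) \<le> elastic (a # xs @ [b])"
  using assms
proof (induction "length xs" arbitrary: xs a)
  case 0
  then show ?case by auto
next
  case (Suc n)
  define c where "c = Min (set xs)"
  have ne: "xs \<noteq> []" using Suc.hyps by auto
  then have "c \<in> set xs" and c_le: "\<And>x. x \<in> set xs \<Longrightarrow> c \<le> x" by (auto simp: c_def)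
  then obtain p q where pq: "xs = p @ c # q" by (auto simp: in_set_conv_decomp)
  have "n = length (rev p @ q)" using Suc.hyps pq by simp
  with Suc.hyps(1)[of "rev p @ q" c] Suc.prems c_le pq
  obtain ys where ys: "mset ys = mset (rev p @ q)" "sorted (c # ys @ [b])"
      "elastic (c # ys @ [b]) \<le> elastic (c # (rev p @ q) @ [b])" by auto
  have "a \<le> c" using Suc.prems pq by auto
  have red: "elastic (a # c # rev p @ q @ [b]) \<le> elastic (a # xs @ [b])"
  proof (cases "p = []")
    case False
    define d where "d = hd (q @ [b])"
    define z where "z = hd p"
    have "hd q = d" if "q \<noteq> []" using that by (simp add: d_def)
    then have d: "elastic (xs' @ q @ [b]) = elastic xs' + (last xs' - d)\<^sup>2 / 2 + elastic (q @ [b])"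
      if "xs' \<noteq> []" for xs'
      using elastic_append[of xs' "q @ [b]"] that by (simp add: d_def)
    have "a \<le> d" using Suc.prems pq \<open>a \<le> c\<close> by (cases q) (auto simp: d_def)
    have "c \<le> z" using False c_le pq by (auto simp: z_def)
    have e1: "elastic (a # xs @ [b]) = (a - z)\<^sup>2 / 2 + elastic (p @ [c]) + (c - d)\<^sup>2 / 2 + elastic (q @ [b])"
      using d[of "a # p @ [c]"] False by (simp add: pq elastic_Cons z_def)
    have e2: "elastic (a # c # rev p @ q @ [b]) = (a - c)\<^sup>2 / 2 + elastic (rev (p @ [c])) + (z - d)\<^sup>2 / 2 + elastic (q @ [b])"
      using d[of "a # c # rev p"] False by (simp add: elastic_Cons z_def last_rev)
    have "0 \<le> (z - c) * (d - a)" using \<open>a \<le> d\<close> \<open>c \<le> z\<close> by simp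
    then show ?thesis unfolding e1 e2 elastic_rev
      by (simp add: power2_eq_square field_simps)
  qed (simp add: pq)
  have "elastic (a # c # ys @ [b]) \<le> elastic (a # c # rev p @ q @ [b])"
    using ys(3) by (simp add: elastic_Cons)
  then have "elastic (a # (c # ys) @ [b]) \<le> elastic (a # xs @ [b])"
    using red by simp
  then show ?case using ys \<open>a \<le> c\<close> Suc.prems(3) pq
    by (intro exI[of _ "c # ys"]) (auto dest: bspec[of _ _ b])
qed

text \<open>Exchanging the interiors of two paths \<open>a # xs @ [b]\<close> and \<open>a' # ys @ [b']\<close> is two successive
  exchanges of tails, each of which changes the elastic energy by the product of two differences.\<close>

lemma elastic_exchange:
  "elastic (a # ys @ [b]) + elastic (a' # xs @ [b']) =
   elastic (a # xs @ [b]) + elastic (a' # ys @ [b'])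
   - (a' - a) * (hd (xs @ [b]) - hd (ys @ [b']))
   - (last (a # ys) - last (a' # xs)) * (b - b')"
proof -
  have first: "elastic (a # xs @ [b]) - elastic (a' # xs @ [b]) = (a - hd (xs @ [b]))\<^sup>2 / 2 - (a' - hd (xs @ [b]))\<^sup>2 / 2"
    for a a' b xs by (cases xs) auto
  have last': "elastic (a # xs @ [b]) - elastic (a # xs @ [b']) = (last (a # xs) - b)\<^sup>2 / 2 - (last (a # xs) - b')\<^sup>2 / 2"
    for a b b' xs using elastic_append[of "a # xs" "[b]"] elastic_append[of "a # xs" "[b']"] by simp
  show ?thesis
    using first[of a xs b a'] first[of a' ys b' a] last'[of a ys b b'] last'[of a' xs b b']
    by (simp add: power2_eq_square field_simps)
qed

text \<open>In the frame of the first copy this is \<open>elastic_exchange\<close> for two paths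
  whose interiors are \<open>us\<close> and \<open>ws\<close> shifted by \<open>- c\<close>. The
  potential energy is unchanged, as is the total number of atoms even when \<open>us\<close> and
  \<open>ws\<close> differ in length.\<close>

lemma energy_swap:
  fixes us ws :: "real list"
  assumes "xs \<noteq> []" "ys \<noteq> []" "zs \<noteq> []"
    and "\<And>x. x \<in> set us \<Longrightarrow> V (x + c) = V x" "\<And>x. x \<in> set ws \<Longrightarrow> V (x - c) = V x"
  shows "energy (xs @ map (\<lambda>x. x - c) ws @ ys @ map (\<lambda>x. x + c) us @ zs) =
    energy (xs @ us @ ys @ ws @ zs)
    - (last ys - c - last xs) * (hd (us @ ys) - (hd (ws @ zs) - c))
    - (last (last xs # map (\<lambda>x. x - c) ws) - last ((last ys - c) # us)) * (hd ys - (hd zs - c))"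
proof -
  have split: "elastic (xs @ us @ ys @ ws @ zs) = elastic xs + elastic (last xs # us @ [hd ys]) + elastic ys
     + elastic (last ys # ws @ [hd zs]) + elastic zs" for us ws
    using assms(1-3) by (cases "us = []"; cases "ws = []") (auto simp: elastic_append elastic_Cons)
  have "elastic (last ys # map (\<lambda>x. x + c) us @ [hd zs]) = elastic (map (\<lambda>x. x + c) ((last ys - c) # us @ [hd zs - c]))"
    by simp
  then have up: "elastic (last ys # map (\<lambda>x. x + c) us @ [hd zs]) = elastic ((last ys - c) # us @ [hd zs - c])"
    by (simp only: elastic_map_add)
  have "elastic (last ys # ws @ [hd zs]) = elastic (map (\<lambda>x. x + c) ((last ys - c) # map (\<lambda>x. x - c) ws @ [hd zs - c]))"
    by (simp add: comp_def)
  then have dn: "elastic (last ys # ws @ [hd zs]) = elastic ((last ys - c) # map (\<lambda>x. x - c) ws @ [hd zs - c])"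
    by (simp only: elastic_map_add)
  have V: "sum_list (map V (xs @ map (\<lambda>x. x - c) ws @ ys @ map (\<lambda>x. x + c) us @ zs)) =
      sum_list (map V (xs @ us @ ys @ ws @ zs))"
  proof -
    have "map V (map (\<lambda>x. x + c) us) = map V us" "map V (map (\<lambda>x. x - c) ws) = map V ws"
      using assms(4,5) by auto
    then show ?thesis by (simp del: map_map)
  qed
  have hd1: "hd (map (\<lambda>x. x - c) ws @ [hd zs - c]) = hd (ws @ zs) - c"
    using assms(3) by (cases ws) auto
  have hd2: "hd (us @ [hd ys]) = hd (us @ ys)"
    using assms(2) by (cases us) auto
  show ?thesis
    unfolding energy_def V split up dn
    using elastic_exchange[of "last xs" "map (\<lambda>x. x - c) ws" "hd ys" "last ys - c" us "hd zs - c"]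
    unfolding hd1 hd2 by linarith
qed

section \<open>Energy-minimal chains between two peaks\<close>

text \<open>Confinement to the interval between the ends makes the set of competitors compact. It
  does no harm in the limit, because any given competitor lies in all large windows.\<close>

definition admissible :: "real \<Rightarrow> real \<Rightarrow> nat \<Rightarrow> real list \<Rightarrow> bool" where
  "admissible lo hi n xs \<longleftrightarrow> length xs = n \<and> xs \<noteq> [] \<and> hd xs = lo \<and> last xs = hi \<and> set xs \<subseteq> {lo..hi}"

definition optimal :: "real \<Rightarrow> real \<Rightarrow> real list \<Rightarrow> bool" where
  "optimal lo hi xs \<longleftrightarrow> admissible lo hi (length xs) xs \<and>
     (\<forall>ys. admissible lo hi (length xs) ys \<longrightarrow> energy xs \<le> energy ys)"

lemma compact_functions_into:
  assumes "\<And>i. compact (K i)"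
  shows "compact {f :: 'a \<Rightarrow> 'b :: topological_space. \<forall>i. f i \<in> K i}"
proof -
  have "compactin (product_topology (\<lambda>_. euclidean) UNIV) (PiE UNIV K)"
    using assms by (subst compactin_PiE) auto
  moreover have "PiE UNIV K = {f. \<forall>i. f i \<in> K i}" by (auto simp: PiE_def Pi_def)
  ultimately show ?thesis by (simp add: euclidean_product_topology)
qed

lemma continuous_on_energy_map:
  "continuous_on UNIV (\<lambda>f :: 'a \<Rightarrow> real. energy (map f is))"
proof -
  have V: "continuous_on UNIV (\<lambda>f :: 'a \<Rightarrow> real. V (f i))" for i
    by (rule continuous_on_compose2[OF continuous_on_V[of UNIV]]) auto
  have "continuous_on UNIV (\<lambda>f :: 'a \<Rightarrow> real. elastic (map f is))"
    by (induction "is" rule: induct_list012) (auto intro!: continuous_intros)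
  moreover have "continuous_on UNIV (\<lambda>f :: 'a \<Rightarrow> real. sum_list (map V (map f is)))"
    by (induction "is") (auto intro!: continuous_intros V)
  ultimately show ?thesis unfolding energy_def by (intro continuous_intros)
qed

lemma exists_optimal:
  assumes "lo \<le> hi" "n \<ge> 2"
  shows "\<exists>xs. length xs = n \<and> optimal lo hi xs"
proof -
  \<comment> \<open>A list is coded by a function on all naturals. The two pinned ends range over
    singletons; indices from n on do not enter the energy.\<close>
  define K where "K = {f :: nat \<Rightarrow> real. \<forall>i. f i \<in> (if i = 0 then {lo} else if i = n - 1 then {hi} else {lo..hi})}"
  have "compact K" unfolding K_def by (intro compact_functions_into) auto
  moreover have "(\<lambda>i. if i = 0 then lo else hi) \<in> K" using assms by (auto simp: K_def)
  then have "K \<noteq> {}" by blast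
  ultimately obtain f where f: "f \<in> K" "\<And>g. g \<in> K \<Longrightarrow> energy (map f [0..<n]) \<le> energy (map g [0..<n])"
    using continuous_attains_inf[of K "\<lambda>f. energy (map f [0..<n])"]
      continuous_on_subset[OF continuous_on_energy_map] by blast
  have adm: "admissible lo hi n (map g [0..<n])" if g: "g \<in> K" for g
  proof -
    have "g i \<in> {lo..hi}" for i using g assms unfolding K_def by (auto dest!: spec[of _ i] split: if_splits)
    moreover have "g 0 = lo" "g (n - 1) = hi"
      using g assms(2) by (auto simp: K_def dest: spec[of _ 0] spec[of _ "n-1"])
    ultimately show ?thesis using assms(2) by (auto simp: admissible_def hd_map last_map)
  qed
  have "energy (map f [0..<n]) \<le> energy ys" if ys: "admissible lo hi n ys" for ys
  proof -
    define g where "g i = (if i < n then ys ! i else lo)" for i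
    have "g \<in> K" using ys assms
      by (auto simp: K_def g_def admissible_def hd_conv_nth last_conv_nth subset_iff)
    moreover have "map g [0..<n] = ys"
      using ys by (intro nth_equalityI) (auto simp: g_def admissible_def)
    ultimately show ?thesis using f(2) by metis
  qed
  then show ?thesis using adm[OF f(1)] by (intro exI[of _ "map f [0..<n]"]) (simp add: optimal_def)
qed

lemma exists_sorted_optimal:
  assumes "lo \<le> hi" "n \<ge> 2"
  shows "\<exists>xs. length xs = n \<and> optimal lo hi xs \<and> sorted xs"
proof -
  obtain xs where xs: "length xs = n" "optimal lo hi xs" using exists_optimal[OF assms] by blast
  obtain a ws where "xs = a # ws" "ws \<noteq> []" using xs assms
    by (cases xs; cases "tl xs") auto
  moreover then obtain us b where "ws = us @ [b]" by (metis append_butlast_last_id)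
  ultimately have eq: "xs = lo # us @ [hi]" using xs by (auto simp: optimal_def admissible_def)
  have "\<exists>ys. mset ys = mset us \<and> sorted (lo # ys @ [hi]) \<and> elastic (lo # ys @ [hi]) \<le> elastic (lo # us @ [hi])"
    using xs assms eq by (intro elastic_sort) (auto simp: optimal_def admissible_def)
  then obtain ys where ys: "mset ys = mset us" "sorted (lo # ys @ [hi])" "elastic (lo # ys @ [hi]) \<le> elastic (lo # us @ [hi])"
    by blast
  have "sum_list (map V ys) = sum_list (map V us)"
    using ys(1) by (metis mset_map sum_mset_sum_list)
  then have le: "energy (lo # ys @ [hi]) \<le> energy xs" using ys eq by (simp add: energy_def)
  have "set ys = set us" "length ys = length us" using ys(1) by (metis set_mset_mset, metis size_mset)
  then have "optimal lo hi (lo # ys @ [hi])"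
    using xs le eq unfolding optimal_def admissible_def by (auto intro: order.trans)
  then show ?thesis using ys(2) xs eq \<open>length ys = length us\<close> by (intro exI[of _ "lo # ys @ [hi]"]) simp
qed

lemma energy_triple:
  "energy (l @ a # t # c # r) - energy (l @ a # b # c # r)
    = ((a - t)\<^sup>2 + (t - c)\<^sup>2) / 2 + V t - (((a - b)\<^sup>2 + (b - c)\<^sup>2) / 2 + V b)"
  by (cases "l = []") (auto simp: energy_def elastic_append add_divide_distrib)

lemma optimal_triple:
  assumes "optimal lo hi (l @ a # b # c # r)" "lo \<le> t" "t \<le> hi"
  shows "((a - b)\<^sup>2 + (b - c)\<^sup>2) / 2 + V b \<le> ((a - t)\<^sup>2 + (t - c)\<^sup>2) / 2 + V t"
proof -
  have "admissible lo hi (length (l @ a # b # c # r)) (l @ a # t # c # r)"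
    using assms by (cases l) (auto simp: optimal_def admissible_def)
  then have "energy (l @ a # b # c # r) \<le> energy (l @ a # t # c # r)"
    using assms by (simp add: optimal_def)
  then show ?thesis using energy_triple[of l a t c r b] by linarith
qed

lemma optimal_stationary:
  assumes "optimal lo hi (l @ a # b # c # r)" "lo < b" "b < hi"
  shows "2 * b - a - c + V' b = 0"
proof -
  let ?f = "\<lambda>t. ((a - t)\<^sup>2 + (t - c)\<^sup>2) / 2 + V t"
  have "(?f has_real_derivative (2 * b - a - c + V' b)) (at b)"
    by (auto intro!: derivative_eq_intros V_has_derivative)
  moreover have "\<forall>t. \<bar>b - t\<bar> < min (b - lo) (hi - b) \<longrightarrow> ?f b \<le> ?f t"
    using optimal_triple[OF assms(1)] by (auto simp: abs_less_iff)
  ultimately show ?thesis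
    using DERIV_local_min[of ?f _ b "min (b - lo) (hi - b)"] assms by simp
qed

lemma list_split_triple:
  "0 < i \<Longrightarrow> i + 1 < length xs \<Longrightarrow>
    xs = take (i - 1) xs @ xs ! (i - 1) # xs ! i # xs ! (i + 1) # drop (i + 2) xs"
  using id_take_nth_drop[of "i - 1" xs] Cons_nth_drop_Suc[of i xs] Cons_nth_drop_Suc[of "i + 1" xs]
  by simp

text \<open>Suppose the atoms p to q coincide at z. For z strictly inside, stationarity at p makes
  \<open>V' z\<close> negative and stationarity at q makes it positive. For z at a pinned end, the
  atom of the cluster next to the rest of the chain can be moved: this lowers the elastic energy,
  and the potential energy cannot rise because the end is a peak.\<close>

lemma optimal_strict:
  assumes opt: "optimal lo hi xs" and "sorted xs" and "lo < hi"
    and top: "V lo = zeta 0" "V hi = zeta 0"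
  shows "sorted_wrt (<) xs"
proof (rule ccontr)
  assume "\<not> sorted_wrt (<) xs"
  then obtain i j where ij: "i < j" "j < length xs" "\<not> xs ! i < xs ! j"
    by (auto simp: sorted_wrt_iff_nth_less)
  define z where "z = xs ! i"
  have mono: "xs ! k \<le> xs ! l" if "k \<le> l" "l < length xs" for k l
    using that \<open>sorted xs\<close> by (simp add: sorted_nth_mono)
  have zj: "xs ! j = z" using ij mono[of i j] by (simp add: z_def)
  define D where "D = {k. k < length xs \<and> xs ! k = z}"
  have D: "finite D" "i \<in> D" "j \<in> D" using ij zj by (auto simp: D_def z_def)
  define p where "p = Min D"
  define q where "q = Max D"
  have pq: "p \<in> D" "q \<in> D" "p < q" "p \<le> i"
    using D ij Min_le[of D i] Max_ge[of D j] Min_in[of D] Max_in[of D] unfolding p_def q_def by (blast, blast, linarith, blast)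
  have hdlast: "xs ! 0 = lo" "xs ! (length xs - 1) = hi"
    using opt by (auto simp: optimal_def admissible_def hd_conv_nth last_conv_nth)
  have range: "xs ! k \<in> {lo..hi}" if "k < length xs" for k
    using opt nth_mem[OF that] unfolding optimal_def admissible_def by blast
  have zb: "lo \<le> z" "z \<le> hi" using range[of i] ij by (auto simp: z_def)
  have before: "xs ! (p - 1) < z \<and> xs ! (p + 1) = z \<and> 0 < p \<and> p + 1 < length xs" if "lo < z"
  proof -
    have "0 < p" using pq(1) hdlast(1) that by (cases p) (auto simp: D_def)
    moreover have "p - 1 \<notin> D" using \<open>0 < p\<close> Min_le[OF D(1), of "p - 1"] by (auto simp: p_def[symmetric])
    moreover have "xs ! (p - 1) \<le> z" using mono[of "p-1" p] pq by (auto simp: D_def)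
    moreover have "xs ! (p + 1) = z" using mono[of p "p+1"] mono[of "p+1" q] pq by (auto simp: D_def)
    ultimately show ?thesis using pq by (auto simp: D_def)
  qed
  have after: "xs ! (q + 1) > z \<and> xs ! (q - 1) = z \<and> 0 < q \<and> q + 1 < length xs" if "z < hi"
  proof -
    have "q \<noteq> length xs - 1" using pq(2) hdlast(2) that by (auto simp: D_def)
    then have "q + 1 < length xs" using pq by (auto simp: D_def)
    moreover have "q + 1 \<notin> D" using Max_ge[OF D(1), of "q + 1"] by (auto simp: q_def[symmetric])
    moreover have "xs ! (q + 1) \<ge> z" using mono[of q "q+1"] pq \<open>q + 1 < length xs\<close> by (auto simp: D_def)
    moreover have "xs ! (q - 1) = z" using mono[of p "q-1"] mono[of "q-1" q] pq by (auto simp: D_def)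
    ultimately show ?thesis using pq by (auto simp: D_def)
  qed
  have zp: "xs ! p = z" and zq: "xs ! q = z" using pq by (auto simp: D_def)
  have stat_p: "2 * z - xs ! (p - 1) - z + V' z = 0" if "lo < z" "z < hi"
  proof -
    have "optimal lo hi (take (p - 1) xs @ xs ! (p - 1) # z # z # drop (p + 2) xs)"
      using opt before[OF that(1)] list_split_triple[of p xs] zp by simp
    from optimal_stationary[OF this that] show ?thesis by simp
  qed
  have opt_q: "optimal lo hi (take (q - 1) xs @ z # z # xs ! (q + 1) # drop (q + 2) xs)" if "z < hi"
    using opt after[OF that] list_split_triple[of q xs] zq by simp
  consider "lo < z" "z < hi" | "z = lo" | "z = hi" using zb by linarith
  then show False
  proof cases
    case 1
    have "2 * z - z - xs ! (q + 1) + V' z = 0"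
      using optimal_stationary[OF opt_q 1] 1 by simp
    then show False using stat_p[OF 1] before after 1 by linarith
  next
    case 2
    \<comment> \<open>The atom q is moved halfway to its right neighbour, which reduces the elastic
      energy from \<open>2 * e * e\<close> to \<open>e * e\<close>.\<close>
    define e where "e = (xs ! (q + 1) - lo) / 2"
    have "e > 0" and x: "xs ! (q + 1) = lo + 2 * e" using after 2 \<open>lo < hi\<close> by (auto simp: e_def field_simps)
    have "lo + 2 * e \<le> hi" using range[of "q + 1"] after 2 \<open>lo < hi\<close> x by auto
    then have "((z - z)\<^sup>2 + (z - xs ! (q + 1))\<^sup>2) / 2 + V z
        \<le> ((z - (lo + e))\<^sup>2 + (lo + e - xs ! (q + 1))\<^sup>2) / 2 + V (lo + e)"
      using \<open>lo < hi\<close> \<open>e > 0\<close> 2 by (intro optimal_triple[OF opt_q]) auto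
    then have "e * e + V lo \<le> V (lo + e)" using 2 x by (simp add: power2_eq_square)
    then show False using V_le[of "lo + e"] top mult_pos_pos[OF \<open>e > 0\<close> \<open>e > 0\<close>] by linarith
  next
    case 3
    define e where "e = (hi - xs ! (p - 1)) / 2"
    have "e > 0" and x: "xs ! (p - 1) = hi - 2 * e" using before 3 \<open>lo < hi\<close> by (auto simp: e_def field_simps)
    have ge: "lo \<le> hi - 2 * e" using range[of "p - 1"] before 3 \<open>lo < hi\<close> x by auto
    have "optimal lo hi (take (p - 1) xs @ xs ! (p - 1) # z # z # drop (p + 2) xs)"
      using opt before list_split_triple[of p xs] zp 3 \<open>lo < hi\<close> by simp
    from optimal_triple[OF this, of "hi - e"]
    have "e * e + V hi \<le> V (hi - e)" using 3 x ge \<open>e > 0\<close> by (simp add: power2_eq_square)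
    then show False using V_le[of "hi - e"] top mult_pos_pos[OF \<open>e > 0\<close> \<open>e > 0\<close>] by linarith
  qed
qed

section \<open>Atom counts in translated blocks\<close>

definition count_below :: "real list \<Rightarrow> real \<Rightarrow> nat" where
  "count_below xs t = card {i. i < length xs \<and> xs ! i < t}"

definition count_upto :: "real list \<Rightarrow> real \<Rightarrow> nat" where
  "count_upto xs t = card {i. i < length xs \<and> xs ! i \<le> t}"

lemma count_below_mono: "s \<le> t \<Longrightarrow> count_below xs s \<le> count_below xs t"
  unfolding count_below_def by (intro card_mono) auto

lemma nat_le_by_less: "(\<And>i. i < m \<Longrightarrow> i < n) \<Longrightarrow> m \<le> (n :: nat)"
  by (meson not_le less_irrefl)

text \<open>A bounded, downward closed set of naturals is an initial segment. This translates
  inequalities between counts into statements about single atoms.\<close>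

lemma less_card_downward_closed:
  assumes down: "\<And>i j. i \<le> j \<Longrightarrow> P j \<Longrightarrow> P i" and bound: "\<And>i. P i \<Longrightarrow> i < n"
  shows "i < card {i :: nat. P i} \<longleftrightarrow> P i"
proof -
  have sub: "{i. P i} \<subseteq> {..<n}"
  proof
    show "i \<in> {..<n}" if "i \<in> {i. P i}" for i using bound[of i] that by simp
  qed
  have fin: "finite {i. P i}" by (rule finite_subset[OF sub]) simp
  show ?thesis
  proof
    assume "P i"
    have "{..i} \<subseteq> {i. P i}"
    proof
      show "k \<in> {i. P i}" if "k \<in> {..i}" for k using down[of k i] that \<open>P i\<close> by simp
    qed
    from card_mono[OF fin this] show "i < card {i. P i}" by simp
  next
    assume less: "i < card {i. P i}"
    show "P i"
    proof (rule ccontr)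
      assume "\<not> P i"
      have "{i. P i} \<subseteq> {..<i}"
      proof
        show "k \<in> {..<i}" if "k \<in> {i. P i}" for k
          using down[of i k] that \<open>\<not> P i\<close> by (cases "i \<le> k") simp_all
      qed
      from card_mono[OF _ this] show False using less by simp
    qed
  qed
qed

lemma less_count_below_iff:
  assumes "sorted xs"
  shows "i < count_below xs t \<longleftrightarrow> i < length xs \<and> xs ! i < t"
  unfolding count_below_def
proof (rule less_card_downward_closed[where n = "length xs"])
  show "i < length xs \<and> xs ! i < t" if "i \<le> j" "j < length xs \<and> xs ! j < t" for i j
    using that sorted_nth_mono[OF assms, of i j] by auto
qed simp

lemma less_count_upto_iff:
  assumes "sorted xs"
  shows "i < count_upto xs t \<longleftrightarrow> i < length xs \<and> xs ! i \<le> t"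
  unfolding count_upto_def
proof (rule less_card_downward_closed[where n = "length xs"])
  show "i < length xs \<and> xs ! i \<le> t" if "i \<le> j" "j < length xs \<and> xs ! j \<le> t" for i j
    using that sorted_nth_mono[OF assms, of i j] by auto
qed simp

text \<open>A nondecreasing integer function that gains at most k - 2 in k steps stands still twice.
  The auxiliary claim also records that f has gained at least one per step on average before the
  standstill, so the remaining steps still have a deficit and contain a second one.\<close>

lemma two_stationary_steps:
  fixes f :: "nat \<Rightarrow> nat"
  assumes mono: "\<And>j. s \<le> j \<Longrightarrow> j < s + k \<Longrightarrow> f j \<le> f (j + 1)" and "f (s + k) + 2 \<le> f s + k"
  shows "\<exists>j1 j2. s \<le> j1 \<and> j1 < j2 \<and> j2 < s + k \<and> f (j1 + 1) = f j1 \<and> f (j2 + 1) = f j2"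
proof -
  have one: "\<exists>j \<ge> s'. j < s' + k' \<and> f (j + 1) = f j \<and> f j \<ge> f s' + (j - s')"
    if "s \<le> s'" "s' + k' \<le> s + k" "f (s' + k') < f s' + k'" for s' k'
    using that
  proof (induction k')
    case (Suc k')
    show ?case
    proof (cases "f (s' + k') < f s' + k'")
      case True
      then obtain j where "j \<ge> s'" "j < s' + k'" "f (j + 1) = f j" "f j \<ge> f s' + (j - s')"
        using Suc by auto
      then show ?thesis by (intro exI[of _ j]) auto
    next
      case False
      then have "f (s' + k' + 1) = f (s' + k')" using mono[of "s' + k'"] Suc.prems by auto
      then show ?thesis using False by (intro exI[of _ "s' + k'"]) auto
    qed
  qed simp
  obtain j1 where j1: "s \<le> j1" "j1 < s + k" "f (j1 + 1) = f j1" "f j1 \<ge> f s + (j1 - s)"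
    using one[of s k] assms(2) by auto
  define k' where "k' = s + k - (j1 + 1)"
  have k': "j1 + 1 + k' = s + k" using j1 by (simp add: k'_def)
  have "f (s + k) < f (j1 + 1) + k'"
    using j1 k' assms(2) by linarith
  with one[of "j1 + 1" k', unfolded k'] obtain j2 where "j1 + 1 \<le> j2" "j2 < s + k" "f (j2 + 1) = f j2"
    using j1 by auto
  with j1 show ?thesis by (intro exI[of _ j1] exI[of _ j2]) auto
qed

lemma map_nth_upt_append:
  "a \<le> b \<Longrightarrow> b \<le> c \<Longrightarrow> map f [a..<b] @ map f [b..<c] = map f [a..<c]"
  by (metis map_append upt_add_eq_append le_Suc_ex)

text \<open>The energy falls by the sum of the two gains, so optimality forces both to vanish; the
  new chain has the same energy and is optimal as well.\<close>

lemma optimal_swap: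
  assumes opt: "optimal lo hi (xs @ us @ ys @ ws @ zs)"
    and ne: "xs \<noteq> []" "ys \<noteq> []" "zs \<noteq> []"
    and us: "\<And>x. x \<in> set us \<Longrightarrow> V (x + c) = V x \<and> lo \<le> x + c \<and> x + c \<le> hi"
    and ws: "\<And>x. x \<in> set ws \<Longrightarrow> V (x - c) = V x \<and> lo \<le> x - c \<and> x - c \<le> hi"
    and gain1: "(last ys - c - last xs) * (hd (us @ ys) - (hd (ws @ zs) - c)) \<ge> 0"
    and gain2: "(last (last xs # map (\<lambda>x. x - c) ws) - last ((last ys - c) # us)) * (hd ys - (hd zs - c)) \<ge> 0"
  shows "optimal lo hi (xs @ map (\<lambda>x. x - c) ws @ ys @ map (\<lambda>x. x + c) us @ zs)"
    and "(last ys - c - last xs) * (hd (us @ ys) - (hd (ws @ zs) - c)) = 0"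
proof -
  let ?o = "xs @ us @ ys @ ws @ zs"
  let ?n = "xs @ map (\<lambda>x. x - c) ws @ ys @ map (\<lambda>x. x + c) us @ zs"
  have len: "length ?n = length ?o" by simp
  have adm: "admissible lo hi (length ?o) ?n"
    using opt ne us ws unfolding optimal_def admissible_def by auto
  then have le: "energy ?o \<le> energy ?n" using opt by (simp add: optimal_def)
  have eq: "energy ?n = energy ?o
    - (last ys - c - last xs) * (hd (us @ ys) - (hd (ws @ zs) - c))
    - (last (last xs # map (\<lambda>x. x - c) ws) - last ((last ys - c) # us)) * (hd ys - (hd zs - c))"
    using us ws by (intro energy_swap ne) auto
  show "(last ys - c - last xs) * (hd (us @ ys) - (hd (ws @ zs) - c)) = 0"
    using gain1 gain2 le eq by linarith
  have "energy ?n = energy ?o" using gain1 gain2 le eq by linarith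
  then show "optimal lo hi ?n" using opt adm unfolding optimal_def len by simp
qed

text \<open>The equation \<open>f (j + 1) = f j\<close> says that the bond from atom j to atom j +
  1, translated by \<open>- c\<close>, lies inside the bond from atom \<open>f j - 1\<close> to atom
  \<open>f j\<close>. Four surplus atoms give two such places, and the pieces between them are
  exchanged. Optimality then makes atom i1 coincide with the translated atom j1, so the new chain
  has the same atom with the same left neighbour but another right neighbour; stationarity excludes
  this.\<close>

lemma count_translate:
  assumes opt: "optimal lo hi xs" and strict: "sorted_wrt (<) xs" and "lo < hi" "0 \<le> l"
    and block: "lo \<le> p" "p + l \<le> hi" and block': "lo \<le> p + c" "p + c + l \<le> hi"
    and disj: "l \<le> \<bar>c\<bar>"
    and V_eq: "\<And>x. p \<le> x \<Longrightarrow> x \<le> p + l \<Longrightarrow> V (x + c) = V x"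
  shows "count_below xs (p + c + l) + count_below xs p
    \<le> count_below xs (p + l) + count_below xs (p + c) + 3"
proof (rule ccontr)
  assume large: "\<not> ?thesis"
  have sorted: "sorted xs" using strict strict_sorted_imp_sorted by blast
  have less: "xs ! i < xs ! j" if "i < j" "j < length xs" for i j
    using strict that by (simp add: sorted_wrt_iff_nth_less)
  have le: "xs ! i \<le> xs ! j" if "i \<le> j" "j < length xs" for i j
    using sorted that by (simp add: sorted_nth_mono)
  define n where "n = length xs"
  have ends: "xs ! 0 = lo" "xs ! (n - 1) = hi" "0 < n"
    using opt by (auto simp: optimal_def admissible_def hd_conv_nth last_conv_nth n_def)
  define b where "b = count_below xs (p + c)"
  define e where "e = count_below xs (p + c + l)"
  have in_block: "b \<le> j \<and> j < e \<longleftrightarrow> j < n \<and> p \<le> xs ! j - c \<and> xs ! j - c < p + l" for j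
    using less_count_below_iff[OF sorted, of j "p + c"] less_count_below_iff[OF sorted, of j "p + c + l"] \<open>0 \<le> l\<close>
    unfolding b_def e_def n_def by auto
  define f where "f j = count_upto xs (xs ! j - c)" for j
  have f_iff: "i < f j \<longleftrightarrow> i < n \<and> xs ! i \<le> xs ! j - c" for i j
    unfolding f_def n_def by (rule less_count_upto_iff[OF sorted])
  have f_le: "f j \<le> count_below xs (p + l)" if "b \<le> j" "j < e" for j
  proof -
    have "i < count_below xs (p + l)" if "i < f j" for i
      using that f_iff less_count_below_iff[OF sorted, of i "p+l"] in_block[of j] \<open>b \<le> j\<close> \<open>j < e\<close>
      by (auto simp: n_def)
    then show ?thesis by (rule nat_le_by_less)
  qed
  have f_ge: "count_below xs p \<le> f j" if "b \<le> j" "j < e" for j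
  proof -
    have "i < f j" if "i < count_below xs p" for i
      using that f_iff less_count_below_iff[OF sorted, of i "p"] in_block[of j] \<open>b \<le> j\<close> \<open>j < e\<close>
      by (auto simp: n_def)
    then show ?thesis by (rule nat_le_by_less)
  qed
  have f_mono: "f j \<le> f (j + 1)" if "j + 1 < n" for j
  proof -
    have "i < f (j + 1)" if "i < f j" for i
      using that less[of j "j + 1"] \<open>j + 1 < n\<close> unfolding f_iff by (auto simp: n_def)
    then show ?thesis by (rule nat_le_by_less)
  qed
  have be: "b + count_below xs (p + l) + 4 \<le> e + count_below xs p"
    using large by (simp add: b_def e_def)
  have "count_below xs p \<le> count_below xs (p + l)"
    using \<open>0 \<le> l\<close> by (intro count_below_mono) simp
  then have "b + 4 \<le> e" using be by linarith
  \<comment> \<open>The first atom b of the copy is skipped, so that \<open>xs ! j1 - c\<close> lies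
    strictly beyond p and cannot be a pinned end. The atoms from b + 1 to e - 1 leave e - b - 2
    steps; together with the two standstills this uses up the excess of 4.\<close>
  define k where "k = e - 1 - (b + 1)"
  have bk: "b + 1 + k = e - 1" using \<open>b + 4 \<le> e\<close> by (simp add: k_def)
  have en: "e \<le> n" using in_block[of "e - 1"] \<open>b + 4 \<le> e\<close> by auto
  have "\<exists>j1 j2. b + 1 \<le> j1 \<and> j1 < j2 \<and> j2 < b + 1 + k \<and> f (j1 + 1) = f j1 \<and> f (j2 + 1) = f j2"
  proof (rule two_stationary_steps)
    show "f j \<le> f (j + 1)" if "b + 1 \<le> j" "j < b + 1 + k" for j
      using that bk en by (intro f_mono) auto
    show "f (b + 1 + k) + 2 \<le> f (b + 1) + k"
    proof -
      have "f (e - 1) \<le> count_below xs (p + l)" "count_below xs p \<le> f (b + 1)" "k + b + 2 = e"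
        using f_le[of "e - 1"] f_ge[of "b + 1"] \<open>b + 4 \<le> e\<close> by (auto simp: k_def)
      then show ?thesis using be unfolding bk by linarith
    qed
  qed
  then obtain j1 j2 where j: "b + 1 \<le> j1" "j1 < j2" "j2 + 1 < e" "f (j1 + 1) = f j1" "f (j2 + 1) = f j2"
    using bk by auto
  have jn: "j2 + 1 < n" using j en by linarith
  have blk: "p \<le> xs ! i - c" "xs ! i - c < p + l" if "b \<le> i" "i \<le> j2 + 1" for i
    using in_block[of i] that j by auto
  have pj1: "p < xs ! j1 - c" using blk(1)[of b] less[of b j1] j jn by (auto simp: n_def)
  have f_pos: "0 < f j1" using f_iff[of 0 j1] ends pj1 block by auto
  \<comment> \<open>Indices start at 0, so the last of the \<open>f j1\<close> atoms up to
    \<open>xs ! j1 - c\<close> has index \<open>f j1 - 1\<close>.\<close>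
  define i1 where "i1 = f j1 - 1"
  define i2 where "i2 = f j2 - 1"
  have "f j1 \<le> f j2"
  proof -
    have "i < f j2" if "i < f j1" for i
      using that less[of j1 j2] j jn unfolding f_iff by (auto simp: n_def)
    then show ?thesis by (rule nat_le_by_less)
  qed
  then have i12: "i1 \<le> i2" by (auto simp: i1_def i2_def)
  have nest: "xs ! (f m - 1) \<le> xs ! m - c \<and> xs ! (m + 1) - c < xs ! f m \<and> f m < n"
    if "f (m + 1) = f m" "j1 \<le> m" "m \<le> j2" for m
  proof -
    have "f j1 \<le> f m"
    proof -
      have "i < f m" if "i < f j1" for i
        using that le[of j1 m] \<open>j1 \<le> m\<close> \<open>m \<le> j2\<close> jn unfolding f_iff by (auto simp: n_def)
      then show ?thesis by (rule nat_le_by_less)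
    qed
    then have "f m - 1 < f m" using f_pos by auto
    then have 1: "xs ! (f m - 1) \<le> xs ! m - c" by (simp only: f_iff)
    have "xs ! (m + 1) - c < hi" using blk(2)[of "m + 1"] that j block by auto
    then have "\<not> n - 1 < f m" using ends f_iff[of "n - 1" "m+1"] that by auto
    then have "f m < n" using ends by auto
    with 1 show ?thesis using f_iff[of "f m" "m + 1"] that by auto
  qed
  have i1: "xs ! i1 \<le> xs ! j1 - c" "xs ! (j1 + 1) - c < xs ! (i1 + 1)" "i1 + 1 < n"
    using nest[OF j(4)] j f_pos by (auto simp: i1_def)
  have i2: "xs ! i2 \<le> xs ! j2 - c" "xs ! (j2 + 1) - c < xs ! (i2 + 1)" "i2 + 1 < n"
    using nest[OF j(5)] j f_pos \<open>f j1 \<le> f j2\<close> by (auto simp: i2_def)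
  have i1_pos: "0 < i1" if "xs ! i1 = xs ! j1 - c"
    using that pj1 ends block by (cases i1) auto
  have range: "lo < xs ! i" "xs ! i < hi" if "0 < i" "i + 1 < n" for i
    using less[of 0 i] less[of i "n - 1"] ends that by (auto simp: n_def)
  let ?s = "\<lambda>a b. map ((!) xs) [a..<b]"
  have xs_eq: "xs = ?s 0 n" unfolding n_def by (simp add: map_nth)
  have U: "V (x + c) = V x \<and> lo \<le> x + c \<and> x + c \<le> hi" if x: "x \<in> set (?s (i1 + 1) (i2 + 1))" for x
  proof -
    obtain i where i: "x = xs ! i" "i1 + 1 \<le> i" "i \<le> i2" using x by auto
    have "p < xs ! i" using blk(1)[of "j1+1"] i1 le[of "i1+1" i] i i2 j by (auto simp: n_def)
    moreover have "xs ! i < p + l" using blk(2)[of j2] i2 le[of i i2] i j by (auto simp: n_def)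
    ultimately show ?thesis using V_eq[of x] block' i by auto
  qed
  have W: "V (x - c) = V x \<and> lo \<le> x - c \<and> x - c \<le> hi" if x: "x \<in> set (?s (j1 + 1) (j2 + 1))" for x
  proof -
    obtain i where i: "x = xs ! i" "j1 + 1 \<le> i" "i \<le> j2" using x by auto
    then show ?thesis using V_eq[of "x - c"] blk[of i] block j by auto
  qed
  have stat: "2 * xs ! i1 - xs ! (i1 - 1) - xs ! (i1 + 1) + V' (xs ! i1) = 0" if "0 < i1"
    using optimal_stationary[of lo hi "take (i1 - 1) xs" "xs ! (i1 - 1)" "xs ! i1" "xs ! (i1 + 1)" "drop (i1 + 2) xs"]
      opt list_split_triple[of i1 xs] that i1 range[of i1] by (simp add: n_def)
  have hd_s: "hd (?s a b @ zs) = xs ! a" "a < b \<Longrightarrow> hd (?s a b) = xs ! a" if "a < b" for a b zs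
    using that by (auto simp: hd_append hd_map)
  \<comment> \<open>Stationarity determines the right neighbour from an atom and its left
    neighbour.\<close>
  have stationary_next: "y = xs ! (i1 + 1)"
    if "optimal lo hi (as @ [xs ! (i1 - 1), xs ! i1] @ y # bs)" "0 < i1" for as y bs
    using optimal_stationary[of lo hi as "xs ! (i1 - 1)" "xs ! i1" y bs] stat that range[of i1] i1 by auto
  have snoc2: "?s a (i1 + 1) = ?s a (i1 - 1) @ [xs ! (i1 - 1), xs ! i1]" if "a + 1 \<le> i1" for a
    using that by (cases i1) auto
  have Cons_s: "[Suc j1..<Suc j2] = Suc j1 # [Suc (Suc j1)..<Suc j2]"
    using j by (simp add: upt_conv_Cons del: upt_Suc)
  have gap: "xs ! (j1 + 1) - c \<noteq> xs ! (i1 + 1)" using i1 by simp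
  note upt_Suc [simp del]
  show False
  proof (cases "c \<ge> l")
    case True
    have "xs ! i2 < xs ! j1"
      using i2(1) blk(2)[of j2] blk(1)[of j1] j True by auto
    then have ij: "i2 < j1" using le[of j1 i2] i2 by (cases "i2 < j1") (auto simp: n_def)
    let ?xs = "?s 0 (i1 + 1)" and ?us = "?s (i1 + 1) (i2 + 1)" and ?ys = "?s (i2 + 1) (j1 + 1)"
      and ?ws = "?s (j1 + 1) (j2 + 1)" and ?zs = "?s (j2 + 1) n"
    have eq: "?xs @ ?us @ ?ys @ ?ws @ ?zs = xs"
      using i12 ij j jn by (subst (5) xs_eq) (simp only: map_nth_upt_append)
    have uy: "hd (?us @ ?ys) = xs ! (i1 + 1)" and wz: "hd (?ws @ ?zs) = xs ! (j1 + 1)"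
      using i12 ij j jn by (simp_all only: map_nth_upt_append hd_s)
    have l1: "last ?ys = xs ! j1" "last ?xs = xs ! i1" "hd ?ys = xs ! (i2 + 1)" "hd ?zs = xs ! (j2 + 1)"
      using i12 ij j jn by (auto simp: last_map hd_map simp del: upt_Suc)
    have l2: "last (xs ! i1 # map (\<lambda>x. x - c) ?ws) = xs ! j2 - c"
      using j by (cases "j2 = Suc j1") (auto simp: last_map)
    have l3: "last ((xs ! j1 - c) # ?us) \<le> xs ! j2 - c"
      using i12 i2 less[of j1 j2] j jn by (auto simp: last_map n_def)
    have opt': "optimal lo hi (?xs @ ?us @ ?ys @ ?ws @ ?zs)" unfolding eq by (rule opt)
    have g1: "0 \<le> (last ?ys - c - last ?xs) * (hd (?us @ ?ys) - (hd (?ws @ ?zs) - c))"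
      unfolding uy wz l1 using i1 by (intro mult_nonneg_nonneg) auto
    have g2: "0 \<le> (last (last ?xs # map (\<lambda>x. x - c) ?ws) - last ((last ?ys - c) # ?us)) * (hd ?ys - (hd ?zs - c))"
      using i2 l3 unfolding l1 l2 by (intro mult_nonneg_nonneg) auto
    have ne: "?xs \<noteq> []" "?ys \<noteq> []" "?zs \<noteq> []" using ij jn by auto
    note swap = optimal_swap[OF opt' ne U W g1 g2]
    have "xs ! i1 = xs ! j1 - c" using swap(2) i1 unfolding uy wz l1 by auto
    then have "0 < i1" by (rule i1_pos)
    with stationary_next[of "?s 0 (i1 - 1)" "xs ! (j1 + 1) - c"] swap(1) gap snoc2[of 0] show False
      by (simp add: Cons_s)
  next
    case False
    \<comment> \<open>The mirror case: the copy with the excess lies on the left. The pieces appear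
      in the other order, the shift is \<open>- c\<close>, and in each gain both factors are
      nonpositive.\<close>
    then have c: "p + c + l \<le> p" using disj by auto
    have "xs ! (j2 + 1) \<le> xs ! j1 - c" "xs ! (j2 + 1) < p"
      using blk(2)[of "j2 + 1"] pj1 c j by auto
    then have "j2 + 1 < f j1" using f_iff jn by auto
    then have ji: "j2 < i1" by (auto simp: i1_def)
    let ?xs = "?s 0 (j1 + 1)" and ?us = "?s (j1 + 1) (j2 + 1)" and ?ys = "?s (j2 + 1) (i1 + 1)"
      and ?ws = "?s (i1 + 1) (i2 + 1)" and ?zs = "?s (i2 + 1) n"
    have eq: "?xs @ ?us @ ?ys @ ?ws @ ?zs = xs"
      using i12 ji j i2 by (subst (5) xs_eq) (simp only: map_nth_upt_append)
    have uy: "hd (?us @ ?ys) = xs ! (j1 + 1)" and wz: "hd (?ws @ ?zs) = xs ! (i1 + 1)"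
      using i12 ji j i2 by (simp_all only: map_nth_upt_append hd_s)
    have l1: "last ?ys = xs ! i1" "last ?xs = xs ! j1" "hd ?ys = xs ! (j2 + 1)" "hd ?zs = xs ! (i2 + 1)"
      using i12 ji j i2 by (auto simp: last_map hd_map simp del: upt_Suc)
    have l2: "last ((xs ! i1 - - c) # ?us) = xs ! j2"
      using j by (simp add: last_map del: upt_Suc)
    have l3: "last (xs ! j1 # map (\<lambda>x. x - - c) ?ws) \<le> xs ! j2"
      using i12 i2 less[of j1 j2] j jn by (auto simp: last_map n_def)
    have opt': "optimal lo hi (?xs @ ?us @ ?ys @ ?ws @ ?zs)" unfolding eq by (rule opt)
    have g1: "0 \<le> (last ?ys - - c - last ?xs) * (hd (?us @ ?ys) - (hd (?ws @ ?zs) - - c))"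
      unfolding uy wz l1 using i1 by (intro mult_nonpos_nonpos) auto
    have g2: "0 \<le> (last (last ?xs # map (\<lambda>x. x - - c) ?ws) - last ((last ?ys - - c) # ?us)) * (hd ?ys - (hd ?zs - - c))"
      using i2 l3 unfolding l1 l2 by (intro mult_nonpos_nonpos) auto
    have ne: "?xs \<noteq> []" "?ys \<noteq> []" "?zs \<noteq> []" using ji i2 by auto
    have U': "V (x + - c) = V x \<and> lo \<le> x + - c \<and> x + - c \<le> hi" if "x \<in> set ?us" for x
      using W[OF that] by simp
    have W': "V (x - - c) = V x \<and> lo \<le> x - - c \<and> x - - c \<le> hi" if "x \<in> set ?ws" for x
      using U[OF that] by simp
    note swap = optimal_swap[OF opt' ne U' W' g1 g2]
    have "xs ! i1 = xs ! j1 - c" using swap(2) i1 unfolding uy wz l1 by auto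
    then have "0 < i1" "xs ! (j2 + 1) < xs ! i1"
      using i1_pos pj1 \<open>xs ! (j2 + 1) < p\<close> by auto
    \<comment> \<open>Hence the left neighbour of atom i1 belongs to the middle part, which the
      exchange leaves alone.\<close>
    then have "j2 + 1 < i1" using le[of i1 "j2 + 1"] jn by (cases "j2 + 1 < i1") (auto simp: n_def)
    with stationary_next[of "?xs @ map (\<lambda>x. x - - c) ?ws @ ?s (j2 + 1) (i1 - 1)" "xs ! (j1 + 1) - c"]
      swap(1) gap snoc2[of "j2 + 1"] \<open>0 < i1\<close> show False
      by (simp add: Cons_s)
  qed
qed

section \<open>Inflation structure of the Fibonacci chain\<close>

definition word_length :: "letter list \<Rightarrow> real" where
  "word_length v = sum_list (map len v)"

lemma word_length_simps [simp]:
  "word_length [] = 0" "word_length (c # v) = len c + word_length v"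
  "word_length (v @ v') = word_length v + word_length v'"
  by (simp_all add: word_length_def)

lemma length_le_word_length: "real (length v) \<le> word_length v"
proof (induction v)
  case (Cons c v)
  then show ?case using len_ge_1[of c] by simp
qed simp

lemma word_length_nonneg: "0 \<le> word_length v"
  using length_le_word_length[of v] by linarith

lemma subst_Nil [simp]: "subst [] = []" and subst_Cons: "subst (c # v) = subst_letter c @ subst v"
  by (simp_all add: subst_def)

text \<open>The tile lengths form an eigenvector of the substitution matrix for the eigenvalue
  \<open>tau\<close>.\<close>

lemma word_length_subst: "word_length (subst v) = tau * word_length v"
proof (induction v)
  case (Cons c v)
  then show ?case using tau_sq by (cases c) (simp_all add: subst_Cons algebra_simps power2_eq_square)
qed simp

lemma word_length_subst_pow: "word_length ((subst ^^ n) v) = tau ^ n * word_length v"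
  by (induction n) (simp_all add: word_length_subst)

lemma subst_pow_append: "(subst ^^ n) (v @ v') = (subst ^^ n) v @ (subst ^^ n) v'"
  by (induction n) (simp_all add: subst_append)

text \<open>The letters of the Fibonacci word have frequency ratio \<open>tau\<close> to 1; this is
  the deviation of a finite word from that ratio.\<close>

definition discrepancy :: "letter list \<Rightarrow> real" where
  "discrepancy v = real (count_list v A) - tau * real (count_list v B)"

lemma discrepancy_simps [simp]:
  "discrepancy [] = 0" "discrepancy (A # v) = 1 + discrepancy v"
  "discrepancy (B # v) = discrepancy v - tau" "discrepancy (v @ v') = discrepancy v + discrepancy v'"
  by (simp_all add: discrepancy_def algebra_simps)

text \<open>\<open>- 1 / tau\<close> is the second eigenvalue of the substitution matrix.\<close>

lemma discrepancy_subst: "tau * discrepancy (subst v) = - discrepancy v"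
proof (induction v)
  case (Cons c v)
  then show ?case using tau_sq by (cases c) (simp_all add: subst_Cons algebra_simps power2_eq_square)
qed simp

text \<open>A cut can split only an image AB, and then leaves a single A behind.\<close>

lemma prefix_subst:
  "prefix p (subst v) \<Longrightarrow> \<exists>q. prefix q v \<and> (p = subst q \<or> p = subst q @ [A])"
proof (induction v arbitrary: p)
  case Nil
  then show ?case by auto
next
  case (Cons c v)
  show ?case
  proof (cases "p = [] \<or> p = [A]")
    case True
    then show ?thesis by (intro exI[of _ "[]"]) auto
  next
    case False
    then obtain p' where p': "p = subst_letter c @ p'" "prefix p' (subst v)"
      using Cons.prems by (cases c) (auto simp: subst_Cons prefix_Cons)
    then obtain q where "prefix q v" "p' = subst q \<or> p' = subst q @ [A]" using Cons.IH by blast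
    then show ?thesis using p' by (intro exI[of _ "c # q"]) (auto simp: subst_Cons)
  qed
qed

text \<open>The bound 3 reproduces itself: inflation reduces it to 3 / \<open>tau\<close>, which is
  at most 2, and an incomplete image at the end adds 1.\<close>

lemma discrepancy_prefix: "prefix p ((subst ^^ k) [A, A]) \<Longrightarrow> \<bar>discrepancy p\<bar> \<le> 3"
proof (induction k arbitrary: p)
  case 0
  then show ?case by (auto simp: prefix_Cons)
next
  case (Suc k)
  then obtain q where q: "prefix q ((subst ^^ k) [A, A])" "p = subst q \<or> p = subst q @ [A]"
    using prefix_subst[of p] by auto
  have "tau * \<bar>discrepancy (subst q)\<bar> \<le> 3"
    using Suc.IH[OF q(1)] discrepancy_subst[of q] tau_pos by (metis abs_minus_cancel abs_mult abs_of_pos)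
  then have "\<bar>discrepancy (subst q)\<bar> \<le> 3 / tau"
    using tau_pos by (simp add: field_simps)
  also have "\<dots> \<le> 2" using tau_bounds by (simp add: field_simps)
  finally show ?case using q(2) by auto
qed

text \<open>For each letter, A followed by the reversed image equals the image followed by A; this A
  travels through the whole word.\<close>

lemma subst_rev: "A # rev (subst v) = subst (rev v) @ [A]"
proof (induction v)
  case (Cons c v)
  have "A # rev (subst (c # v)) = (A # rev (subst v)) @ rev (subst_letter c)"
    by (simp add: subst_Cons)
  also have "\<dots> = subst (rev (c # v)) @ [A]"
    unfolding Cons.IH by (cases c) (simp_all add: subst_append subst_Cons)
  finally show ?case .
qed simp

text \<open>If v is a palindrome, so is \<open>subst v @ [A]\<close>, by \<open>subst_rev\<close>.
  The last two letters alternate because AB is mapped to ABA and BA to AAB.\<close>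

lemma subst_pow_palindrome:
  "\<exists>v. rev v = v \<and> (subst ^^ Suc n) [A] = v @ (if odd n then [B, A] else [A, B])"
proof (induction n)
  case 0
  then show ?case by (simp add: subst_def)
next
  case (Suc n)
  then obtain v where v: "rev v = v" "(subst ^^ Suc n) [A] = v @ (if odd n then [B, A] else [A, B])" by blast
  have "rev (subst v @ [A]) = subst v @ [A]" using subst_rev[of v] v(1) by simp
  moreover have "(subst ^^ Suc (Suc n)) [A] = subst ((subst ^^ Suc n) [A])" by simp
  then have "(subst ^^ Suc (Suc n)) [A] = (subst v @ [A]) @ (if odd (Suc n) then [B, A] else [A, B])"
    unfolding v(2) by (auto simp: subst_append subst_Cons)
  ultimately show ?case by blast
qed

section \<open>Location of the inflated words and of their potentials in the chain\<close>

lemma w_nonneg: "k < length ((subst ^^ n) [A]) \<Longrightarrow> w (int k) = (subst ^^ n) [A] ! k"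
  using u_eq_u_fin[of "Suc n" k] by (simp add: w_def u_fin_def)

text \<open>Left of 0 stands BA, preceded by the reversed right half. For even exponents the
  inflated word is a palindrome followed by BA, so it appears there in its ordinary reading
  direction.\<close>

lemma w_neg:
  assumes "m \<ge> 1" "k < length ((subst ^^ (2 * m)) [A])"
  shows "w (int k - int (length ((subst ^^ (2 * m)) [A]))) = (subst ^^ (2 * m)) [A] ! k"
proof -
  obtain v where v: "rev v = v" "(subst ^^ (2 * m)) [A] = v @ [B, A]"
  proof -
    have "Suc (2 * m - 1) = 2 * m" "odd (2 * m - 1)" using assms(1) by auto
    then show thesis using subst_pow_palindrome[of "2 * m - 1"] that by auto
  qed
  consider "k < length v" | "k = length v" | "k = length v + 1" using assms(2) v by fastforce
  then show ?thesis
  proof cases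
    case 1
    define l where "l = length v - 1 - k"
    have l: "l < length v" "int k - int (length v + 2) = - 3 - int l" using 1 by (auto simp: l_def)
    have "w (int k - int (length v + 2)) = u l" unfolding l(2) by (simp add: w_def)
    also have "\<dots> = v ! l" using w_nonneg[of l "2 * m"] l v by (simp add: w_def nth_append)
    also have "\<dots> = v ! k" using 1 v(1) rev_nth[of k v] by (simp add: l_def)
    finally show ?thesis using v 1 by (simp add: nth_append)
  qed (auto simp: v w_def nth_append)
qed

text \<open>The potential over the tiles of a word, measured from their left end. The value
  \<open>zeta 0\<close> for the empty word is the peak that remains at the right end.\<close>

fun word_potential :: "letter list \<Rightarrow> real \<Rightarrow> real" where
  "word_potential [] t = zeta 0"
| "word_potential (c # v) t =
    (if t \<le> len c then gap_potential (len c) t else word_potential v (t - len c))"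

lemma word_potential_0: "word_potential v 0 = zeta 0"
  using len_ge_1 by (cases v) (auto simp: gap_potential_def min_def intro: order.trans[of 0 1])

lemma word_potential_append1:
  "0 \<le> t \<Longrightarrow> t \<le> word_length v \<Longrightarrow> word_potential (v @ v') t = word_potential v t"
  by (induction v arbitrary: t) (auto simp: word_potential_0)

lemma word_potential_append2:
  "0 \<le> t \<Longrightarrow> word_potential (v @ v') (word_length v + t) = word_potential v' t"
proof (induction v)
  case (Cons c v)
  show ?case
  proof (cases "word_length v + t = 0")
    case True
    then have "t = 0" "word_length v = 0" using Cons.prems word_length_nonneg[of v] by auto
    then show ?thesis using Cons.IH len_ge_1[of c] by (simp add: word_potential_0 gap_potential_def min_def)
  next
    case False
    then have "word_length v + t > 0" using Cons.prems word_length_nonneg[of v] by auto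
    then show ?thesis using Cons by (simp add: algebra_simps)
  qed
qed simp

lemma S_word:
  "(\<And>k. k < length v \<Longrightarrow> w (i + int k) = v ! k) \<Longrightarrow> S (i + int (length v)) = S i + word_length v"
proof (induction v arbitrary: i)
  case (Cons c v)
  have "w (i + 1 + int k) = v ! k" if "k < length v" for k
    using Cons.prems[of "Suc k"] that by (simp add: algebra_simps)
  from Cons.IH[OF this] have "S (i + 1 + int (length v)) = S (i + 1) + word_length v" .
  then show ?case using S_succ[of i] Cons.prems[of 0] by (simp add: algebra_simps)
qed simp

lemma V_word:
  "(\<And>k. k < length v \<Longrightarrow> w (i + int k) = v ! k) \<Longrightarrow> 0 \<le> t \<Longrightarrow> t \<le> word_length v
    \<Longrightarrow> V (S i + t) = word_potential v t"
proof (induction v arbitrary: i t)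
  case Nil
  then show ?case by (simp add: V_S)
next
  case (Cons c v)
  have c: "w i = c" using Cons.prems(1)[of 0] by simp
  show ?case
  proof (cases "t \<le> len c")
    case True
    then show ?thesis using V_gap[of i "S i + t"] Cons.prems c by (simp add: S_succ)
  next
    case False
    have "w (i + 1 + int k) = v ! k" if "k < length v" for k
      using Cons.prems(1)[of "Suc k"] that by (simp add: algebra_simps)
    from Cons.IH[OF this, of "t - len c"] False Cons.prems(3) show ?thesis
      using S_succ[of i] c by (simp add: algebra_simps)
  qed
qed

text \<open>The length of \<open>(subst ^^ (2 * m)) [A]\<close>, which lies on either side of
  0.\<close>

definition window :: "nat \<Rightarrow> real" where
  "window m = tau ^ (2 * m + 1)"

lemma V_window:
  assumes "m \<ge> 1" "- window m \<le> x" "x \<le> window m"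
  shows "V x = word_potential ((subst ^^ (2 * m)) [A, A]) (x + window m)"
    and "V (- window m) = zeta 0" "V (window m) = zeta 0"
proof -
  define v where "v = (subst ^^ (2 * m)) [A]"
  have vv: "(subst ^^ (2 * m)) [A, A] = v @ v" using subst_pow_append[of "2*m" "[A]" "[A]"] by (simp add: v_def)
  have len: "word_length v = window m" by (simp add: v_def word_length_subst_pow window_def)
  have w: "w (- int (length v) + int k) = (v @ v) ! k" if "k < length (v @ v)" for k
  proof (cases "k < length v")
    case True
    then show ?thesis using w_neg[OF assms(1), of k] by (simp add: v_def nth_append)
  next
    case False
    then show ?thesis using w_nonneg[of "k - length v" "2 * m"] that by (simp add: v_def nth_append of_nat_diff)
  qed
  have "S (- int (length v) + int (length v)) = S (- int (length v)) + word_length v"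
    using w by (intro S_word) (simp add: nth_append)
  then have S: "S (- int (length v)) = - window m" by (simp add: S_0 len)
  show "V x = word_potential ((subst ^^ (2 * m)) [A, A]) (x + window m)"
    using V_word[of "v @ v" "- int (length v)" "x + window m"] w assms by (simp add: S vv len)
  show "V (- window m) = zeta 0" using V_S[of "- int (length v)"] by (simp add: S)
  have "S (- int (length v) + int (length (v @ v))) = S (- int (length v)) + word_length (v @ v)"
    using w by (intro S_word)
  then have "S (int (length v)) = window m" by (simp add: S len)
  then show "V (window m) = zeta 0" using V_S[of "int (length v)"] by simp
qed

text \<open>The window is tiled by the n-fold inflated letters of
  \<open>(subst ^^ (2 * m - n)) [A, A]\<close>; this is the left end of block r, counted from
  0.\<close>

definition block_start :: "nat \<Rightarrow> nat \<Rightarrow> nat \<Rightarrow> real" where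
  "block_start m n r = - window m + tau ^ n * word_length (take r ((subst ^^ (2 * m - n)) [A, A]))"

lemma V_block:
  assumes "m \<ge> 1" "n \<le> 2 * m" and v: "v = (subst ^^ (2 * m - n)) [A, A]" and "r < length v"
    and "0 \<le> t" "t \<le> tau ^ n * len (v ! r)"
  shows "V (block_start m n r + t) = word_potential ((subst ^^ n) [v ! r]) t"
proof -
  let ?a = "(subst ^^ n) (take r v)" and ?b = "(subst ^^ n) [v ! r]" and ?c = "(subst ^^ n) (drop (Suc r) v)"
  have "(subst ^^ (2 * m)) [A, A] = (subst ^^ (n + (2 * m - n))) [A, A]" using assms(2) by simp
  also have "\<dots> = (subst ^^ n) v" unfolding funpow_add v by simp
  also have "v = take r v @ [v ! r] @ drop (Suc r) v" using assms(4) by (simp add: id_take_nth_drop[symmetric])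
  then have "(subst ^^ n) v = ?a @ ?b @ ?c" by (metis subst_pow_append)
  finally have W: "(subst ^^ (2 * m)) [A, A] = ?a @ ?b @ ?c" .
  have a: "word_length ?a = tau ^ n * word_length (take r v)" by (simp add: word_length_subst_pow)
  have b: "word_length ?b = tau ^ n * len (v ! r)" by (simp add: word_length_subst_pow)
  have "word_length (?a @ ?b @ ?c) = 2 * window m"
    unfolding W[symmetric] word_length_subst_pow by (simp add: window_def)
  then have total: "word_length ?a + word_length ?b \<le> 2 * window m"
    using word_length_nonneg[of ?c] by simp
  have "V (block_start m n r + t) = word_potential (?a @ ?b @ ?c) (word_length ?a + t)"
  proof (subst V_window(1)[OF assms(1)])
    show "- window m \<le> block_start m n r + t"
      using word_length_nonneg[of ?a] assms(5) unfolding block_start_def v[symmetric] a[symmetric] by simp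
    show "block_start m n r + t \<le> window m"
      using total assms(6) b unfolding block_start_def v[symmetric] a[symmetric] by simp
  qed (simp_all add: W block_start_def v[symmetric] a)
  also have "\<dots> = word_potential (?b @ ?c) t" using assms(5) by (rule word_potential_append2)
  also have "\<dots> = word_potential ?b t" using assms(5,6) b by (intro word_potential_append1) auto
  finally show ?thesis .
qed

section \<open>Density of atoms\<close>

lemma block_start_Suc:
  assumes "v = (subst ^^ (2 * m - n)) [A, A]" "r < length v"
  shows "block_start m n (Suc r) = block_start m n r + tau ^ n * len (v ! r)"
  using assms(2) unfolding block_start_def assms(1)[symmetric]
  by (simp add: take_Suc_conv_app_nth algebra_simps)

lemma block_start_mono: "r \<le> s \<Longrightarrow> block_start m n r \<le> block_start m n s"
proof -
  assume "r \<le> s"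
  let ?v = "(subst ^^ (2 * m - n)) [A, A]"
  have "take s ?v = take r ?v @ drop r (take s ?v)"
    using append_take_drop_id[of r "take s ?v"] \<open>r \<le> s\<close> by (simp add: min_absorb1)
  then have "word_length (take s ?v) = word_length (take r ?v) + word_length (drop r (take s ?v))"
    by (metis word_length_simps(3))
  then show ?thesis
    using word_length_nonneg tau_pos unfolding block_start_def by simp
qed

lemma block_start_0: "block_start m n 0 = - window m"
  by (simp add: block_start_def)

lemma block_start_length:
  assumes "n \<le> 2 * m" "v = (subst ^^ (2 * m - n)) [A, A]"
  shows "block_start m n (length v) = window m"
proof -
  have "tau ^ n * tau ^ (2 * m - n) = tau ^ (2 * m)" using assms(1) by (simp flip: power_add)
  then show ?thesis unfolding block_start_def assms(2)
    by (simp add: word_length_subst_pow window_def mult.assoc[symmetric])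
qed

lemma window_pos: "0 < window m"
  using tau_pos by (simp add: window_def)

text \<open>Blocks with the same letter are translates of each other that do not overlap and carry
  the same potential, so \<open>count_translate\<close> applies.\<close>

lemma count_blocks:
  assumes "m \<ge> 1" "n \<le> 2 * m" and v: "v = (subst ^^ (2 * m - n)) [A, A]"
    and opt: "optimal (- window m) (window m) xs" "sorted_wrt (<) xs"
    and r: "r < length v" "r' < length v" "v ! r = v ! r'"
  shows "count_below xs (block_start m n (Suc r)) + count_below xs (block_start m n r')
    \<le> count_below xs (block_start m n (Suc r')) + count_below xs (block_start m n r) + 3"
proof (cases "r = r'")
  case False
  define l where "l = tau ^ n * len (v ! r)"
  define p where "p = block_start m n r'"
  define c where "c = block_start m n r - p"
  have l: "0 \<le> l" using tau_pos len_ge_1[of "v ! r"] by (simp add: l_def)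
  have next_r: "block_start m n (Suc r) = p + c + l" and next_r': "block_start m n (Suc r') = p + l"
    using block_start_Suc[OF v r(1)] block_start_Suc[OF v r(2)] r(3) by (simp_all add: l_def p_def c_def)
  have ends: "- window m \<le> block_start m n s" "s \<le> length v \<Longrightarrow> block_start m n s \<le> window m" for s
    using block_start_mono[of 0 s m n] block_start_mono[of s "length v" m n] block_start_0
      block_start_length[OF assms(2) v] by auto
  have disj: "l \<le> \<bar>c\<bar>"
  proof (cases "r < r'")
    case True
    then have "p + c + l \<le> p" using block_start_mono[of "Suc r" r' m n] next_r by (simp add: p_def)
    then show ?thesis by linarith
  next
    case False
    with \<open>r \<noteq> r'\<close> have "p + l \<le> p + c"
      using block_start_mono[of "Suc r'" r m n] next_r' by (simp add: c_def)
    then show ?thesis by linarith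
  qed
  have V_eq: "V (x + c) = V x" if "p \<le> x" "x \<le> p + l" for x
    using V_block[OF assms(1,2) v r(1), of "x - p"] V_block[OF assms(1,2) v r(2), of "x - p"] that r(3)
    by (simp add: l_def p_def c_def algebra_simps)
  have "count_below xs (p + c + l) + count_below xs p \<le> count_below xs (p + l) + count_below xs (p + c) + 3"
  proof (rule count_translate[OF opt _ l _ _ _ _ disj V_eq])
    show "- window m < window m" using window_pos[of m] by simp
    show "- window m \<le> p" "p + l \<le> window m" "- window m \<le> p + c" "p + c + l \<le> window m"
      using ends(1)[of r'] ends(2)[of "Suc r'"] ends(1)[of r] ends(2)[of "Suc r"] r
      unfolding next_r next_r' by (auto simp: p_def c_def)
  qed
  then show ?thesis using next_r next_r' by (simp add: p_def c_def)
qed simp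

text \<open>The increment at one chosen position of each letter serves as d; a letter that does not
  occur gets 0. Other positions deviate by at most C each.\<close>

lemma additive_up_to_letter:
  fixes g :: "nat \<Rightarrow> real" and v :: "letter list"
  assumes mono: "\<And>r. g r \<le> g (Suc r)"
    and close: "\<And>r r'. r < length v \<Longrightarrow> r' < length v \<Longrightarrow> v ! r = v ! r' \<Longrightarrow>
      g (Suc r) - g r \<le> g (Suc r') - g r' + C"
    and "0 \<le> C"
  shows "\<exists>d. (\<forall>c. 0 \<le> d c) \<and> (\<forall>r s. r \<le> s \<and> s \<le> length v \<longrightarrow>
     \<bar>g s - g r - (\<Sum>i = r..<s. d (v ! i))\<bar> \<le> C * real (s - r))"
proof -
  define d where "d c = (if \<exists>r < length v. v ! r = c
    then let r = (SOME r. r < length v \<and> v ! r = c) in g (Suc r) - g r else 0)" for c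
  have "0 \<le> d c" for c using mono by (auto simp: d_def Let_def)
  moreover have step: "\<bar>g (Suc r) - g r - d (v ! r)\<bar> \<le> C" if "r < length v" for r
  proof -
    define r' where "r' = (SOME r'. r' < length v \<and> v ! r' = v ! r)"
    have r': "r' < length v \<and> v ! r' = v ! r" unfolding r'_def by (rule someI[of _ r]) (simp add: that)
    have "d (v ! r) = g (Suc r') - g r'" using that unfolding d_def r'_def Let_def by auto
    then show ?thesis using close[of r r'] close[of r' r] r' that by auto
  qed
  have "\<bar>g s - g r - (\<Sum>i = r..<s. d (v ! i))\<bar> \<le> C * real (s - r)" if "r \<le> s" "s \<le> length v" for r s
    using that
  proof (induction s rule: dec_induct)
    case (step s)
    have "real (Suc s - r) = real (s - r) + 1" using step.hyps by (simp add: of_nat_diff)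
    then have "C * real (Suc s - r) = C * real (s - r) + C" by (simp add: algebra_simps)
    moreover have "\<bar>g (Suc s) - g s - d (v ! s)\<bar> \<le> C" using step.prems \<open>\<And>r. r < length v \<Longrightarrow> _\<close> by simp
    moreover have "\<bar>g s - g r - (\<Sum>i = r..<s. d (v ! i))\<bar> \<le> C * real (s - r)" using step by simp
    ultimately show ?case using step.hyps by simp
  qed simp
  ultimately show ?thesis by blast
qed

lemma sum_letters:
  fixes d :: "letter \<Rightarrow> real"
  assumes "r \<le> s" "s \<le> length v"
  shows "(\<Sum>i = r..<s. d (v ! i)) =
    (real (count_list (take s v) A) - real (count_list (take r v) A)) * d A
    + (real (count_list (take s v) B) - real (count_list (take r v) B)) * d B"
  using assms
proof (induction s rule: dec_induct)
  case (step s)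
  then show ?case
    by (cases "v ! s") (simp_all add: take_Suc_conv_app_nth algebra_simps)
qed simp

lemma word_length_count: "word_length v = tau * real (count_list v A) + real (count_list v B)"
proof (induction v)
  case (Cons c v)
  then show ?case by (cases c) (simp_all add: algebra_simps)
qed simp

text \<open>Here dA and dB stand for the atoms in the two kinds of blocks, and lengths are measured
  in units of \<sigma>. In the orthogonal basis (\<open>tau\<close>, 1), (1, \<open>- tau\<close>),
  the coefficient \<kappa> is a number of atoms per unit length, while h is multiplied only by the
  bounded discrepancy. The total T over the whole window fixes \<kappa> up to 5; the factor 8 for a
  part is this 5 plus its own error 3.\<close>

lemma density_estimate:
  fixes dA dB \<sigma> \<theta> L T \<alpha> \<beta> :: real
  assumes "0 \<le> dA" "0 \<le> dB" "0 < \<sigma>" "1 \<le> \<theta>"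
    and whole: "\<bar>T - (\<alpha> * dA + \<beta> * dB)\<bar> \<le> 3 * L" "\<bar>\<alpha> - tau * \<beta>\<bar> \<le> 6" "L = tau * \<alpha> + \<beta>"
    and T: "\<bar>T - L * \<sigma> / \<theta>\<bar> \<le> 1" and L: "24 * (\<sigma> + 4) \<le> L"
    and part: "\<bar>g - (\<alpha>' * dA + \<beta>' * dB)\<bar> \<le> 3 * l" "\<bar>\<alpha>' - tau * \<beta>'\<bar> \<le> 6" "l = tau * \<alpha>' + \<beta>'" "0 \<le> l"
  shows "\<bar>g - l * \<sigma> / \<theta>\<bar> \<le> 8 * l + 24 * (\<sigma> + 4)"
proof -
  define \<kappa> where "\<kappa> = (tau * dA + dB) / (tau\<^sup>2 + 1)"
  define h where "h = (dA - tau * dB) / (tau\<^sup>2 + 1)"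
  have pos: "0 < tau\<^sup>2 + 1" by (rule add_nonneg_pos) auto
  have \<kappa>h: "(tau\<^sup>2 + 1) * \<kappa> = tau * dA + dB" "(tau\<^sup>2 + 1) * h = dA - tau * dB"
    using pos by (simp_all add: \<kappa>_def h_def)
  have "(tau\<^sup>2 + 1) * (tau * \<kappa> + h) = tau * ((tau\<^sup>2 + 1) * \<kappa>) + (tau\<^sup>2 + 1) * h"
    "(tau\<^sup>2 + 1) * (\<kappa> - tau * h) = (tau\<^sup>2 + 1) * \<kappa> - tau * ((tau\<^sup>2 + 1) * h)"
    by (simp_all add: algebra_simps)
  then have "(tau\<^sup>2 + 1) * (tau * \<kappa> + h) = (tau\<^sup>2 + 1) * dA" "(tau\<^sup>2 + 1) * (\<kappa> - tau * h) = (tau\<^sup>2 + 1) * dB"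
    unfolding \<kappa>h by (simp_all add: algebra_simps power2_eq_square)
  then have dA: "dA = tau * \<kappa> + h" and dB: "dB = \<kappa> - tau * h"
    using pos by (simp_all add: less_imp_neq[OF pos, symmetric])
  have split: "a * dA + b * dB = (tau * a + b) * \<kappa> + (a - tau * b) * h" for a b
    unfolding dA dB by (simp add: algebra_simps)
  have "\<bar>dA - tau * dB\<bar> \<le> 2 * (tau * dA + dB)"
  proof -
    have "tau * dA \<ge> 1 * dA" "tau * dB \<le> 2 * dB" "0 \<le> tau * dA" "0 \<le> tau * dB"
      using assms(1,2) tau_bounds mult_right_mono[of 1 tau dA] mult_right_mono[of tau 2 dB] by auto
    then have "dA - tau * dB \<le> 2 * (tau * dA + dB)" "- (dA - tau * dB) \<le> 2 * (tau * dA + dB)"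
      using assms(1,2) by (simp_all add: distrib_left)
    then show ?thesis by (rule abs_leI)
  qed
  then have h: "\<bar>h\<bar> \<le> 2 * \<kappa>"
    using pos unfolding h_def \<kappa>_def by (simp add: divide_right_mono abs_divide)
  have \<kappa>0: "0 \<le> \<kappa>" using h by linarith
  have err: "\<bar>x * h\<bar> \<le> 12 * \<kappa>" if "\<bar>x\<bar> \<le> 6" for x
  proof -
    have "\<bar>x\<bar> * \<bar>h\<bar> \<le> 6 * (2 * \<kappa>)" using that h by (intro mult_mono) auto
    then show ?thesis by (simp add: abs_mult)
  qed
  have Lpos: "0 < L" "96 \<le> L" using L \<open>0 < \<sigma>\<close> by auto
  have dev: "\<bar>L * \<kappa> - L * \<sigma> / \<theta>\<bar> \<le> 1 + 3 * L + 12 * \<kappa>"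
    using whole(1) T err[OF whole(2)] unfolding split whole(3)[symmetric] by linarith
  have \<sigma>\<theta>: "L * \<sigma> / \<theta> \<le> L * \<sigma>" using Lpos \<open>0 < \<sigma>\<close> \<open>1 \<le> \<theta>\<close> divide_left_mono[of 1 \<theta> "L * \<sigma>"] by simp
  \<comment> \<open>Half of \<open>L * \<kappa>\<close> absorbs the term
    \<open>12 * \<kappa>\<close>, which gives an a priori bound on \<kappa>. With it,
    \<open>12 * \<kappa>\<close> is at most L.\<close>
  have "24 * \<kappa> \<le> L * \<kappa>" using \<kappa>0 Lpos by (intro mult_right_mono) auto
  then have "L * \<kappa> \<le> L * (2 * (\<sigma> + 4))" using dev \<sigma>\<theta> Lpos by (simp add: algebra_simps)
  then have \<kappa>: "\<kappa> \<le> 2 * (\<sigma> + 4)" using Lpos by simp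
  then have "12 * \<kappa> \<le> L" using L by linarith
  then have "\<bar>L * \<kappa> - L * \<sigma> / \<theta>\<bar> \<le> L * 5" using dev Lpos by linarith
  then have "L * \<bar>\<kappa> - \<sigma> / \<theta>\<bar> \<le> L * 5"
    using Lpos abs_mult[of L "\<kappa> - \<sigma> / \<theta>"] by (simp add: right_diff_distrib)
  then have "\<bar>\<kappa> - \<sigma> / \<theta>\<bar> \<le> 5" using Lpos by simp
  then have "l * \<bar>\<kappa> - \<sigma> / \<theta>\<bar> \<le> l * 5" using part(4) by (intro mult_left_mono)
  then have "\<bar>l * \<kappa> - l * \<sigma> / \<theta>\<bar> \<le> l * 5"
    using part(4) abs_mult[of l "\<kappa> - \<sigma> / \<theta>"] by (simp add: right_diff_distrib)
  moreover have "\<bar>g - l * \<kappa>\<bar> \<le> 3 * l + 12 * \<kappa>"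
    using part(1) err[OF part(2)] unfolding split part(3)[symmetric] by linarith
  ultimately show ?thesis using \<kappa> by linarith
qed

lemma count_below_nth:
  assumes "sorted_wrt (<) xs" "j < length xs"
  shows "count_below xs (xs ! j) = j"
proof -
  have sorted: "sorted xs" using assms(1) strict_sorted_imp_sorted by blast
  have "i < count_below xs (xs ! j) \<longleftrightarrow> i < j" for i
    using less_count_below_iff[OF sorted, of i] assms sorted_nth_mono[OF sorted, of j i]
    by (auto simp: sorted_wrt_iff_nth_less not_less[symmetric] intro: ccontr)
  then show ?thesis by (meson antisym nat_le_by_less)
qed

lemma block_containing:
  assumes "n \<le> 2 * m" and v: "v = (subst ^^ (2 * m - n)) [A, A]" and s: "- window m \<le> s" "s \<le> window m"
  shows "\<exists>r < length v. block_start m n r \<le> s \<and> s \<le> block_start m n (Suc r)"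
proof -
  have "length v \<noteq> 0"
    using block_start_length[OF assms(1) v] block_start_0[of m n] window_pos[of m] by (intro notI) auto
  then have last: "s \<le> block_start m n (Suc (length v - 1))"
    using block_start_length[OF assms(1) v] s by simp
  define r where "r = (LEAST r. s \<le> block_start m n (Suc r))"
  have 1: "s \<le> block_start m n (Suc r)" unfolding r_def by (rule LeastI, rule last)
  have 2: "r \<le> length v - 1" unfolding r_def by (rule Least_le, rule last)
  have "block_start m n r \<le> s"
  proof (cases r)
    case (Suc k)
    then show ?thesis using not_less_Least[of k "\<lambda>r. s \<le> block_start m n (Suc r)"] by (simp add: r_def)
  qed (simp add: block_start_0 s)
  moreover have "r < length v" using 2 \<open>length v \<noteq> 0\<close> by linarith
  ultimately show ?thesis using 1 by blast
qed

text \<open>The number of bonds is the length of the window divided by the desired mean spacing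
  \<theta>, rounded down.\<close>

definition balanced :: "real \<Rightarrow> nat \<Rightarrow> real list \<Rightarrow> bool" where
  "balanced \<theta> m xs \<longleftrightarrow> optimal (- window m) (window m) xs \<and> sorted_wrt (<) xs \<and>
     length xs = nat \<lfloor>2 * window m / \<theta>\<rfloor> + 1"

lemma balanced_ends:
  assumes "balanced \<theta> m xs"
  shows "xs ! 0 = - window m" "xs ! (length xs - 1) = window m" "xs \<noteq> []"
    "count_below xs (- window m) = 0" "count_below xs (window m) = length xs - 1"
proof -
  show *: "xs ! 0 = - window m" "xs ! (length xs - 1) = window m" "xs \<noteq> []"
    using assms by (auto simp: balanced_def optimal_def admissible_def hd_conv_nth last_conv_nth)
  show "count_below xs (- window m) = 0" "count_below xs (window m) = length xs - 1"
    using count_below_nth[of xs 0] count_below_nth[of xs "length xs - 1"] assms *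
    by (auto simp: balanced_def)
qed

lemma exists_balanced:
  assumes "1 \<le> \<theta>" "\<theta> \<le> 3" "m \<ge> 1"
  shows "\<exists>xs. balanced \<theta> m xs"
proof -
  have "tau ^ 2 \<le> tau ^ (2 * m + 1)" using tau_bounds assms(3) by (intro power_increasing) auto
  then have "2 \<le> window m" using tau_sq tau_bounds by (simp add: window_def)
  then have "1 \<le> 2 * window m / \<theta>" using assms by (simp add: field_simps)
  then have "1 \<le> \<lfloor>2 * window m / \<theta>\<rfloor>" by (simp add: le_floor_iff)
  then have "2 \<le> nat \<lfloor>2 * window m / \<theta>\<rfloor> + 1" by linarith
  then obtain xs where xs: "length xs = nat \<lfloor>2 * window m / \<theta>\<rfloor> + 1"
      "optimal (- window m) (window m) xs" "sorted xs"
    using exists_sorted_optimal[of "- window m" "window m"] window_pos[of m] by fastforce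
  have "- window m \<le> 0" "0 \<le> window m" using window_pos[of m] by auto
  then have "sorted_wrt (<) xs"
    using optimal_strict[OF xs(2,3)] window_pos[of m] V_window(2,3)[OF assms(3), of 0] by simp
  with xs show ?thesis by (auto simp: balanced_def)
qed

lemma block_density:
  assumes "1 \<le> \<theta>" "m \<ge> 1" "n \<le> 2 * m" and v: "v = (subst ^^ (2 * m - n)) [A, A]"
    and xs: "balanced \<theta> m xs" and large: "24 * (tau ^ n + 4) \<le> word_length v"
    and r: "r \<le> s" "s \<le> length v"
  shows "\<bar>real (count_below xs (block_start m n s)) - real (count_below xs (block_start m n r))
      - (block_start m n s - block_start m n r) / \<theta>\<bar>
    \<le> 8 * ((block_start m n s - block_start m n r) / tau ^ n) + 24 * (tau ^ n + 4)"
proof -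
  define g where "g r = real (count_below xs (block_start m n r))" for r
  define \<sigma> where "\<sigma> = tau ^ n"
  have \<sigma>: "0 < \<sigma>" using tau_pos by (simp add: \<sigma>_def)
  note xs' = xs[unfolded balanced_def]
  have "\<exists>d. (\<forall>c. 0 \<le> d c) \<and> (\<forall>r s. r \<le> s \<and> s \<le> length v \<longrightarrow>
     \<bar>g s - g r - (\<Sum>i = r..<s. d (v ! i))\<bar> \<le> 3 * real (s - r))"
  proof (rule additive_up_to_letter)
    show "g r \<le> g (Suc r)" for r
      unfolding g_def by (simp add: count_below_mono block_start_mono)
    show "g (Suc r) - g r \<le> g (Suc r') - g r' + 3"
      if "r < length v" "r' < length v" "v ! r = v ! r'" for r r'
      using count_blocks[OF assms(2,3) v _ _ that] xs' unfolding g_def by fastforce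
  qed simp
  then obtain d where d: "\<And>c. 0 \<le> d c" and
    add: "\<And>r s. r \<le> s \<Longrightarrow> s \<le> length v \<Longrightarrow> \<bar>g s - g r - (\<Sum>i = r..<s. d (v ! i))\<bar> \<le> 3 * real (s - r)"
    by blast
  define a where "a s = real (count_list (take s v) A)" for s
  define b where "b s = real (count_list (take s v) B)" for s
  define l where "l s = word_length (take s v)" for s
  have l: "l s = tau * a s + b s" for s
    unfolding l_def a_def b_def by (rule word_length_count)
  have disc: "\<bar>a s - tau * b s\<bar> \<le> 3" for s
    using discrepancy_prefix[of "take s v" "2 * m - n"] v
    by (simp add: a_def b_def discrepancy_def take_is_prefix)
  have z: "block_start m n s - block_start m n r = \<sigma> * (l s - l r)" for r s
    unfolding block_start_def v[symmetric] l_def \<sigma>_def by (simp add: algebra_simps)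
  have l_ge: "real (s - r) \<le> l s - l r" if "r \<le> s" "s \<le> length v" for r s
  proof -
    have "take s v = take r v @ drop r (take s v)"
      using append_take_drop_id[of r "take s v"] that(1) by (simp add: min_absorb1)
    then have "l s = l r + word_length (drop r (take s v))"
      unfolding l_def by (metis word_length_simps(3))
    then show ?thesis using length_le_word_length[of "drop r (take s v)"] that by (simp add: of_nat_diff)
  qed
  have part: "\<bar>(g s - g r) - ((a s - a r) * d A + (b s - b r) * d B)\<bar> \<le> 3 * (l s - l r)"
    if "r \<le> s" "s \<le> length v" for r s
  proof -
    have "3 * real (s - r) \<le> 3 * (l s - l r)" using l_ge[OF that] by simp
    with add[OF that] show ?thesis unfolding sum_letters[OF that] a_def b_def by (rule order.trans)
  qed
  \<comment> \<open>A word between two block boundaries is a difference of two prefixes, hence 3 +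
    3.\<close>
  have disc': "\<bar>(a s - a r) - tau * (b s - b r)\<bar> \<le> 6" for r s
    using disc[of s] disc[of r] by (simp add: right_diff_distrib)
  have l': "l s - l r = tau * (a s - a r) + (b s - b r)" for r s
    unfolding l by (simp add: algebra_simps)
  let ?N = "length v"
  have gN: "g ?N - g 0 = real (nat \<lfloor>2 * window m / \<theta>\<rfloor>)"
    using balanced_ends[OF xs] xs' block_start_length[OF assms(3) v] block_start_0[of m n]
    unfolding g_def by simp
  have lN: "(l ?N - l 0) * \<sigma> = 2 * window m"
    using z[of ?N 0] block_start_length[OF assms(3) v] block_start_0[of m n] by (simp add: mult.commute)
  have "0 \<le> 2 * window m / \<theta>" using window_pos[of m] assms(1) by simp
  then have T: "\<bar>(g ?N - g 0) - (l ?N - l 0) * \<sigma> / \<theta>\<bar> \<le> 1"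
    unfolding gN lN by linarith
  have L: "24 * (\<sigma> + 4) \<le> l ?N - l 0" using large by (simp add: l_def \<sigma>_def)
  have main: "\<bar>g s - g r - (l s - l r) * \<sigma> / \<theta>\<bar> \<le> 8 * (l s - l r) + 24 * (\<sigma> + 4)"
    using l_ge[OF r]
    by (intro density_estimate[OF d d \<sigma> assms(1) part[of 0 ?N] disc' l' T L part[OF r] disc' l']) auto
  have e: "(block_start m n s - block_start m n r) / \<sigma> = l s - l r"
    using \<sigma> unfolding z by simp
  have e': "(block_start m n s - block_start m n r) / \<theta> = (l s - l r) * \<sigma> / \<theta>"
    unfolding z by (simp add: mult.commute)
  show ?thesis unfolding g_def[symmetric] \<sigma>_def[symmetric] e e' by (rule main)
qed

text \<open>Whole blocks that cover the interval give the upper bound, and whole blocks inside it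
  the lower one. \<open>K\<close> and \<open>m0\<close> depend on n, but the estimate is uniform in
  m and therefore passes to the limit.\<close>

lemma density:
  assumes "1 \<le> \<theta>"
  shows "\<exists>K m0. \<forall>m \<ge> m0. \<forall>xs. balanced \<theta> m xs \<longrightarrow> (\<forall>s t. - window m \<le> s \<and> s \<le> t \<and> t \<le> window m \<longrightarrow>
    \<bar>real (count_below xs t) - real (count_below xs s) - (t - s) / \<theta>\<bar> \<le> 8 * ((t - s) / tau ^ n) + K)"
proof -
  define \<sigma> where "\<sigma> = tau ^ n"
  have \<sigma>: "0 < \<sigma>" using tau_pos by (simp add: \<sigma>_def)
  \<comment> \<open>The first summand comes from \<open>block_density\<close>. Passing to block ends
    changes the length by at most \<open>4 * \<sigma>\<close>, which costs at most
    \<open>4 * \<sigma>\<close> in the main term and 8 times 4 in the error term.\<close>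
  define K where "K = 24 * (\<sigma> + 4) + 4 * \<sigma> + 32"
  obtain k where k: "24 * (\<sigma> + 4) < tau ^ k" using real_arch_pow[of tau] tau_bounds by fastforce
  show ?thesis
  proof (intro exI[of _ K] exI[of _ "n + k + 1"] allI impI)
    fix m xs s t
    assume m: "n + k + 1 \<le> m" and xs: "balanced \<theta> m xs" and st: "- window m \<le> s \<and> s \<le> t \<and> t \<le> window m"
    define v where "v = (subst ^^ (2 * m - n)) [A, A]"
    have m': "m \<ge> 1" "n \<le> 2 * m" using m by auto
    have "tau ^ k \<le> tau ^ (2 * m - n)" using m tau_bounds by (intro power_increasing) auto
    moreover have "0 < tau ^ (2 * m - n)" using tau_pos by simp
    then have "tau ^ (2 * m - n) * 1 \<le> tau ^ (2 * m - n) * (tau + tau)"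
      using tau_bounds by (intro mult_left_mono) auto
    ultimately have "24 * (\<sigma> + 4) \<le> tau ^ (2 * m - n) * (tau + tau)"
      using k by linarith
    then have large: "24 * (tau ^ n + 4) \<le> word_length v"
      by (simp add: v_def word_length_subst_pow \<sigma>_def)
    let ?z = "block_start m n"
    define c where "c x = real (count_below xs x)" for x
    have c_mono: "c x \<le> c y" if "x \<le> y" for x y using count_below_mono[OF that] by (simp add: c_def)
    have blk: "\<bar>c (?z s) - c (?z r) - (?z s - ?z r) / \<theta>\<bar> \<le> 8 * ((?z s - ?z r) / \<sigma>) + 24 * (\<sigma> + 4)"
      if "r \<le> s" "s \<le> length v" for r s
      using block_density[OF assms m' v_def xs large that] by (simp add: c_def \<sigma>_def)
    obtain r where r: "r < length v" "?z r \<le> s" "s \<le> ?z (Suc r)"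
      using block_containing[OF m'(2) v_def, of s] st by auto
    obtain q where q: "q < length v" "?z q \<le> t" "t \<le> ?z (Suc q)"
      using block_containing[OF m'(2) v_def, of t] st by auto
    have width: "?z (Suc r) \<le> ?z r + 2 * \<sigma>" if "r < length v" for r
      using block_start_Suc[OF v_def that] len_le_2[of "v ! r"] \<sigma> by (simp add: \<sigma>_def)
    have \<theta>_le: "x / \<theta> \<le> x" if "0 \<le> x" for x using that assms divide_left_mono[of 1 \<theta> x] by simp
    have upper: "c t - c s - (t - s) / \<theta> \<le> 8 * ((t - s) / \<sigma>) + K"
    proof (cases "s = t")
      case False
      then have "\<not> Suc q \<le> r" using block_start_mono[of "Suc q" r m n] r q st by auto
      then have "r \<le> Suc q" by simp
      define Z where "Z = ?z (Suc q) - ?z r"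
      have Z: "Z \<le> (t - s) + 4 * \<sigma>" using width[OF r(1)] width[OF q(1)] r q by (simp add: Z_def)
      have "c t - c s \<le> c (?z (Suc q)) - c (?z r)" using c_mono[OF q(3)] c_mono[OF r(2)] by simp
      also have "\<dots> \<le> Z / \<theta> + 8 * (Z / \<sigma>) + 24 * (\<sigma> + 4)"
        using blk[OF \<open>r \<le> Suc q\<close>] q(1) by (auto simp: Z_def)
      also have "Z / \<theta> \<le> (t - s) / \<theta> + 4 * \<sigma>"
        using divide_right_mono[OF Z, of \<theta>] \<theta>_le[of "4 * \<sigma>"] assms \<sigma> by (simp add: add_divide_distrib)
      also have "Z / \<sigma> \<le> (t - s) / \<sigma> + 4"
        using divide_right_mono[OF Z, of \<sigma>] \<sigma> by (simp add: add_divide_distrib)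
      then have "8 * (Z / \<sigma>) \<le> 8 * ((t - s) / \<sigma>) + 32" by linarith
      finally show ?thesis by (simp add: K_def)
    qed (use \<sigma> in \<open>simp add: K_def\<close>)
    have lower: "(t - s) / \<theta> - (c t - c s) \<le> 8 * ((t - s) / \<sigma>) + K"
    proof (cases "q \<le> r")
      case True
      then have "?z (Suc q) \<le> ?z (Suc r)" by (intro block_start_mono) simp
      then have "t - s \<le> 2 * \<sigma>" using width[OF r(1)] r q by linarith
      moreover have "0 \<le> (t - s) / \<sigma>" using st \<sigma> by simp
      moreover have "(t - s) / \<theta> \<le> t - s" "c s \<le> c t" using st by (auto intro: \<theta>_le c_mono)
      moreover define D E where "D = (t - s) / \<sigma>" and "E = (t - s) / \<theta>"
      ultimately show ?thesis using \<sigma> unfolding K_def D_def[symmetric] E_def[symmetric] by simp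
    next
      case False
      then have "Suc r \<le> q" by simp
      define Z where "Z = ?z q - ?z (Suc r)"
      have Z: "t - s \<le> Z + 4 * \<sigma>" "Z \<le> t - s" using width[OF r(1)] width[OF q(1)] r q by (simp_all add: Z_def)
      have "(t - s) / \<theta> \<le> Z / \<theta> + 4 * \<sigma>"
        using divide_right_mono[OF Z(1), of \<theta>] \<theta>_le[of "4 * \<sigma>"] assms \<sigma> by (simp add: add_divide_distrib)
      moreover have "8 * (Z / \<sigma>) \<le> 8 * ((t - s) / \<sigma>)"
        using Z(2) \<sigma> by (intro mult_left_mono divide_right_mono) auto
      moreover have "Z / \<theta> - 8 * (Z / \<sigma>) - 24 * (\<sigma> + 4) \<le> c (?z q) - c (?z (Suc r))"
        using blk[OF \<open>Suc r \<le> q\<close>] q(1) by (auto simp: Z_def)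
      moreover have "c (?z q) - c (?z (Suc r)) \<le> c t - c s" using c_mono[OF q(2)] c_mono[OF r(3)] by simp
      ultimately show ?thesis using \<sigma> unfolding K_def by linarith
    qed
    show "\<bar>real (count_below xs t) - real (count_below xs s) - (t - s) / \<theta>\<bar> \<le> 8 * ((t - s) / tau ^ n) + K"
      using upper lower unfolding c_def \<sigma>_def by linarith
  qed
qed

section \<open>Minimal configurations as limits\<close>

lemma has_rotation_numberI:
  assumes "\<And>e. 0 < e \<Longrightarrow> \<exists>K. \<forall>i. \<bar>x i - of_int i * r\<bar> \<le> e * \<bar>of_int i\<bar> + K"
  shows "has_rotation_number x r"
proof -
  have large: "\<exists>B. \<forall>i. real_of_int B \<le> \<bar>of_int i\<bar> \<longrightarrow> dist (x i / of_int i) r < e" if "0 < e" for e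
  proof -
    obtain K where K: "\<forall>i. \<bar>x i - of_int i * r\<bar> \<le> e / 2 * \<bar>of_int i\<bar> + K"
      using assms[of "e / 2"] \<open>0 < e\<close> by (meson half_gt_zero)
    define B where "B = \<lceil>2 * \<bar>K\<bar> / e\<rceil> + 1"
    have "dist (x i / of_int i) r < e" if i: "real_of_int B \<le> \<bar>of_int i\<bar>" for i
    proof -
      have "2 * \<bar>K\<bar> / e < \<bar>real_of_int i\<bar>" using i unfolding B_def by linarith
      then have "\<bar>K\<bar> < e / 2 * \<bar>real_of_int i\<bar>" using \<open>0 < e\<close> by (simp add: field_simps)
      then have lt: "\<bar>x i - of_int i * r\<bar> < e * \<bar>real_of_int i\<bar>" using K[rule_format, of i] by linarith
      then have "i \<noteq> 0" by auto
      then have "dist (x i / of_int i) r = \<bar>x i - of_int i * r\<bar> / \<bar>real_of_int i\<bar>"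
        by (simp add: dist_real_def field_simps flip: abs_divide)
      then show ?thesis using lt \<open>i \<noteq> 0\<close> by (simp add: divide_less_eq)
    qed
    then show ?thesis by blast
  qed
  have "\<forall>\<^sub>F i in at_top. dist (x i / of_int i) r < e" "\<forall>\<^sub>F i in at_bot. dist (x i / of_int i) r < e" if "0 < e" for e
  proof -
    obtain B where B: "\<And>i. real_of_int B \<le> \<bar>of_int i\<bar> \<Longrightarrow> dist (x i / of_int i) r < e"
      using large[OF \<open>0 < e\<close>] by blast
    have "dist (x i / of_int i) r < e" if "\<bar>B\<bar> \<le> \<bar>i\<bar>" for i using that by (intro B) linarith
    then have "\<forall>i \<ge> \<bar>B\<bar>. dist (x i / of_int i) r < e" "\<forall>i \<le> - \<bar>B\<bar>. dist (x i / of_int i) r < e"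
      by simp_all
    then show "\<forall>\<^sub>F i in at_top. dist (x i / of_int i) r < e" "\<forall>\<^sub>F i in at_bot. dist (x i / of_int i) r < e"
      unfolding eventually_at_top_linorder eventually_at_bot_linorder by blast+
  qed
  then show ?thesis by (simp add: has_rotation_number_def tendsto_iff)
qed

lemma energy_middle:
  assumes "q \<noteq> []" "q' \<noteq> []" "hd q = hd q'" "last q = last q'"
  shows "energy (p @ q @ s) - energy (p @ q' @ s) = energy q - energy q'"
  using assms by (cases "p = []"; cases "s = []") (simp_all add: energy_def elastic_append)

lemma optimal_middle:
  assumes opt: "optimal lo hi (p @ q @ s)" and "q \<noteq> []"
    and "length q' = length q" "hd q' = hd q" "last q' = last q" "set q' \<subseteq> {lo..hi}"
  shows "energy q \<le> energy q'"
proof -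
  have ne: "q' \<noteq> []" using assms(2,3) by auto
  have "hd (p @ q' @ s) = hd (p @ q @ s)" "last (p @ q' @ s) = last (p @ q @ s)"
    using assms ne by (simp_all add: hd_append last_append)
  then have "admissible lo hi (length (p @ q @ s)) (p @ q' @ s)"
    using opt assms ne unfolding optimal_def admissible_def by auto
  then have "energy (p @ q @ s) \<le> energy (p @ q' @ s)" using opt by (simp add: optimal_def)
  then show ?thesis using energy_middle[of q q' p s] assms ne by simp
qed

lemma energy_map_upto:
  assumes "j \<le> k"
  shows "energy (map x [j..k]) = segment_energy H x j k + V (x k)"
  using assms
proof (induction k rule: int_ge_induct)
  case base
  then show ?case by (simp add: energy_def segment_energy_def)
next
  case (step k)
  have "[j..k + 1] = [j..k] @ [k + 1]" using step.hyps upto_rec2[of j "k + 1"] by simp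
  moreover have "last (map x [j..k]) = x k" using step.hyps upto_rec2[of j k] by simp
  moreover have "{j..<k + 1} = insert k {j..<k}" using step.hyps by auto
  moreover have "[j..k] \<noteq> []" using step.hyps by simp
  ultimately show ?case using step.IH
    by (simp add: energy_def segment_energy_def elastic_append H_def)
qed

lemma segment_energy_tendsto:
  assumes "\<And>i. j \<le> i \<Longrightarrow> i \<le> k \<Longrightarrow> (\<lambda>n. x n i) \<longlonglongrightarrow> y i"
  shows "(\<lambda>n. segment_energy H (x n) j k) \<longlonglongrightarrow> segment_energy H y j k"
proof -
  have V: "(\<lambda>n. V (z n)) \<longlonglongrightarrow> V a" if "z \<longlonglongrightarrow> a" for z a
    using V_has_derivative[of a] that by (intro isCont_tendsto_compose[of a V]) (auto dest: DERIV_isCont)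
  show ?thesis unfolding segment_energy_def H_def
    by (intro tendsto_sum tendsto_intros V assms) auto
qed

text \<open>Index 0 is given to the first atom that is not left of 0. Beyond the chain the ideal
  position \<open>of_int i * \<theta>\<close> is the default, so that
  \<open>centred_deviation\<close> holds at every index.\<close>

definition centred :: "real \<Rightarrow> real list \<Rightarrow> int \<Rightarrow> real" where
  "centred \<theta> xs i = (let j = i + int (count_below xs 0) in
     if 0 \<le> j \<and> j < int (length xs) then xs ! nat j else of_int i * \<theta>)"

lemma centred_minimal:
  assumes xs: "balanced \<theta> m xs" and "j < k"
    and win: "0 \<le> j + int (count_below xs 0)" "k + int (count_below xs 0) < int (length xs)"
    and y: "y j = centred \<theta> xs j" "y k = centred \<theta> xs k" "\<And>i. j \<le> i \<Longrightarrow> i \<le> k \<Longrightarrow> \<bar>y i\<bar> \<le> window m"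
  shows "segment_energy H (centred \<theta> xs) j k \<le> segment_energy H y j k"
proof -
  let ?c = "int (count_below xs 0)"
  define a where "a = nat (j + ?c)"
  define b where "b = nat (k + ?c)"
  have ab: "a < b" "b < length xs" using win \<open>j < k\<close> by (auto simp: a_def b_def)
  define q where "q = map (centred \<theta> xs) [j..k]"
  have "[j..k] = [j..k - 1] @ [k]" using \<open>j < k\<close> by (intro upto_rec2) simp
  then have "last [j..k] = k" by (metis last_snoc)
  then have jk: "[j..k] \<noteq> []" "hd [j..k] = j" "last [j..k] = k"
    using \<open>j < k\<close> upto_rec1[of j k] by auto
  have "q = take (b + 1 - a) (drop a xs)"
  proof (rule nth_equalityI)
    show "length q = length (take (b + 1 - a) (drop a xs))"
      using ab win \<open>j < k\<close> by (simp add: q_def a_def b_def)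
    show "q ! i = take (b + 1 - a) (drop a xs) ! i" if "i < length q" for i
    proof -
      have "int i \<le> k - j" using that by (simp add: q_def)
      then have "q ! i = xs ! nat (j + int i + ?c)" using win
        by (simp add: q_def nth_upto centred_def Let_def)
      moreover have "nat (j + int i + ?c) = a + i" using win by (simp add: a_def nat_add_distrib[symmetric] algebra_simps)
      moreover have "i < b + 1 - a" using \<open>int i \<le> k - j\<close> win by (simp add: a_def b_def)
      ultimately show ?thesis using ab by simp
    qed
  qed
  then have xs_eq: "xs = take a xs @ q @ drop (b + 1) xs"
    using ab append_take_drop_id[of "b + 1 - a" "drop a xs"] by simp
  have "energy q \<le> energy (map y [j..k])"
  proof (rule optimal_middle)
    show "optimal (- window m) (window m) (take a xs @ q @ drop (b + 1) xs)"
      using xs xs_eq by (simp add: balanced_def)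
    show "q \<noteq> []" "length (map y [j..k]) = length q" using jk by (simp_all add: q_def)
    show "hd (map y [j..k]) = hd q" "last (map y [j..k]) = last q"
      using jk y by (simp_all add: q_def hd_map last_map)
    show "set (map y [j..k]) \<subseteq> {- window m..window m}" using y(3) by (auto simp: abs_le_iff minus_le_iff)
  qed
  then show ?thesis unfolding q_def using energy_map_upto[of j k] \<open>j < k\<close> y(2) by simp
qed

text \<open>The atoms are distinct, so counting the atoms below a given one returns its index; the
  density estimate between 0 and that atom then compares index and position.\<close>

lemma centred_deviation:
  assumes xs: "balanced \<theta> m xs" and "0 < \<theta>" "0 \<le> K"
    and dens: "\<And>s t. - window m \<le> s \<Longrightarrow> s \<le> t \<Longrightarrow> t \<le> window m \<Longrightarrow>
      \<bar>real (count_below xs t) - real (count_below xs s) - (t - s) / \<theta>\<bar> \<le> 8 * ((t - s) / \<sigma>) + K"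
    and "0 < \<sigma>"
  shows "\<bar>of_int i - centred \<theta> xs i / \<theta>\<bar> \<le> 8 * (\<bar>centred \<theta> xs i\<bar> / \<sigma>) + K"
proof (cases "0 \<le> i + int (count_below xs 0) \<and> i + int (count_below xs 0) < int (length xs)")
  case True
  define j where "j = nat (i + int (count_below xs 0))"
  have j: "j < length xs" "real j = of_int i + real (count_below xs 0)"
    using True by (auto simp: j_def)
  have c: "centred \<theta> xs i = xs ! j" using True by (simp add: centred_def Let_def j_def)
  have strict: "sorted_wrt (<) xs" and set: "set xs \<subseteq> {- window m..window m}"
    using xs by (auto simp: balanced_def optimal_def admissible_def)
  have range: "xs ! j \<in> {- window m..window m}" using nth_mem[OF j(1)] set by blast
  have count: "real (count_below xs (xs ! j)) = of_int i + real (count_below xs 0)"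
    using count_below_nth[OF strict j(1)] j(2) by simp
  show ?thesis
  proof (cases "0 \<le> xs ! j")
    case True
    then show ?thesis using dens[of 0 "xs ! j"] range window_pos[of m] unfolding count c by simp
  next
    case False
    then have "\<bar>real (count_below xs 0) - real (count_below xs (xs ! j)) - (0 - xs ! j) / \<theta>\<bar>
        \<le> 8 * ((0 - xs ! j) / \<sigma>) + K"
      using range window_pos[of m] by (intro dens) auto
    then show ?thesis using False unfolding count c by (simp add: abs_minus_commute)
  qed
next
  case False
  then have "centred \<theta> xs i = of_int i * \<theta>" by (auto simp: centred_def Let_def)
  then show ?thesis using \<open>0 < \<theta>\<close> \<open>0 \<le> K\<close> \<open>0 < \<sigma>\<close> by simp
qed

lemma window_ge: "real m \<le> window m"
proof -
  have "real m \<le> 1 + real (2 * m + 1) * (6/10)" by (simp add: field_simps)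
  also have "\<dots> \<le> (1 + 6/10) ^ (2 * m + 1)"
    by (rule Bernoulli_inequality) simp
  also have "\<dots> \<le> window m" unfolding window_def using tau_bounds by (intro power_mono) auto
  finally show ?thesis .
qed

lemma exists_minimal_configuration:
  assumes \<theta>: "1 \<le> \<theta>" "\<theta> \<le> 3"
  shows "\<exists>x. minimal_configuration H x \<and> has_rotation_number x \<theta>"
proof -
  have "\<exists>xs. 1 \<le> m \<longrightarrow> balanced \<theta> m xs" for m using exists_balanced[OF \<theta>, of m] by blast
  then obtain xs where xs: "\<And>m. 1 \<le> m \<Longrightarrow> balanced \<theta> m (xs m)" by metis
  have "\<exists>K m0. 0 \<le> K \<and> (\<forall>m \<ge> m0. \<forall>s t. 1 \<le> m \<longrightarrow> - window m \<le> s \<longrightarrow> s \<le> t \<longrightarrow> t \<le> window m \<longrightarrow>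
    \<bar>real (count_below (xs m) t) - real (count_below (xs m) s) - (t - s) / \<theta>\<bar> \<le> 8 * ((t - s) / tau ^ n) + K)" for n
  proof -
    obtain K m0 where K: "\<forall>m \<ge> m0. \<forall>xs. balanced \<theta> m xs \<longrightarrow> (\<forall>s t. - window m \<le> s \<and> s \<le> t \<and> t \<le> window m \<longrightarrow>
      \<bar>real (count_below xs t) - real (count_below xs s) - (t - s) / \<theta>\<bar> \<le> 8 * ((t - s) / tau ^ n) + K)"
      using density[OF \<theta>(1), of n] by blast
    show ?thesis
    proof (intro exI[of _ "max 0 K"] exI[of _ m0] conjI allI impI)
      fix m s t assume "m0 \<le> m" "1 \<le> m" "- window m \<le> s" "s \<le> t" "t \<le> window m"
      with K xs[of m] have "\<bar>real (count_below (xs m) t) - real (count_below (xs m) s) - (t - s) / \<theta>\<bar>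
        \<le> 8 * ((t - s) / tau ^ n) + K" by blast
      then show "\<bar>real (count_below (xs m) t) - real (count_below (xs m) s) - (t - s) / \<theta>\<bar>
        \<le> 8 * ((t - s) / tau ^ n) + max 0 K" by linarith
    qed simp
  qed
  then obtain K m0 where K0: "\<And>n. 0 \<le> K n" and
    K: "\<And>n m s t. m0 n \<le> m \<Longrightarrow> 1 \<le> m \<Longrightarrow> - window m \<le> s \<Longrightarrow> s \<le> t \<Longrightarrow> t \<le> window m \<Longrightarrow>
     \<bar>real (count_below (xs m) t) - real (count_below (xs m) s) - (t - s) / \<theta>\<bar> \<le> 8 * ((t - s) / tau ^ n) + K n"
    by metis
  \<comment> \<open>At this fixed level the error is at most half of the main term, which bounds
    each position by an \<open>R i\<close> that does not depend on k.\<close>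
  obtain n0 where n0: "16 * \<theta> < tau ^ n0" using real_arch_pow[of tau] tau_bounds by fastforce
  have small: "8 * (a / tau ^ n0) \<le> a / (2 * \<theta>)" if "0 \<le> a" for a
  proof -
    have "a * (16 * \<theta>) \<le> a * tau ^ n0" using that n0 by (intro mult_left_mono) auto
    then show ?thesis using \<theta> tau_pos by (simp add: field_simps)
  qed
  define m where "m k = k + m0 n0 + 1" for k
  define y where "y k = centred \<theta> (xs (m k))" for k
  have bal: "balanced \<theta> (m k) (xs (m k))" for k by (intro xs) (simp add: m_def)
  have dev: "\<bar>of_int i - y k i / \<theta>\<bar> \<le> 8 * (\<bar>y k i\<bar> / tau ^ n) + K n" if "m0 n \<le> m k" for n k i
    unfolding y_def
  proof (rule centred_deviation[OF bal])
    show "0 < \<theta>" "0 \<le> K n" "0 < tau ^ n" using \<theta> K0 tau_pos by auto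
  qed (use K that in \<open>simp add: m_def\<close>)
  define R where "R i = 2 * \<theta> * (\<bar>of_int i\<bar> + K n0)" for i :: int
  have y_bound: "\<bar>y k i\<bar> \<le> R i" for k i
  proof -
    have "\<bar>y k i / \<theta>\<bar> \<le> \<bar>of_int i\<bar> + 8 * (\<bar>y k i\<bar> / tau ^ n0) + K n0"
      using dev[of n0 k i] by (simp add: m_def)
    then have "\<bar>y k i\<bar> / \<theta> \<le> \<bar>of_int i\<bar> + \<bar>y k i\<bar> / (2 * \<theta>) + K n0"
      using small[of "\<bar>y k i\<bar>"] \<theta> by (simp add: abs_divide)
    then show ?thesis using \<theta> by (simp add: R_def field_simps)
  qed
  define C where "C = {f :: int \<Rightarrow> real. \<forall>i. f i \<in> cball 0 (R i)}"
  \<comment> \<open>Over a countable index set the product topology is metrizable, so a subsequence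
    converges at every index.\<close>
  have "compact C" unfolding C_def by (intro compact_functions_into) auto
  then have "seq_compact C" by (simp add: compact_eq_seq_compact_metric)
  moreover have "\<forall>k. y k \<in> C" using y_bound by (simp add: C_def)
  ultimately obtain l r where l: "l \<in> C" "strict_mono r" "(y \<circ> r) \<longlonglongrightarrow> l"
    by (rule seq_compactE)
  have lim: "(\<lambda>k. y (r k) i) \<longlonglongrightarrow> l i" for i
    using continuous_on_tendsto_compose[OF continuous_on_product_coordinates[of i] l(3)] by (simp add: comp_def)
  have r_ge: "k \<le> m (r k)" for k using seq_suble[OF l(2), of k] by (simp add: m_def)
  have l_bound: "\<bar>l i\<bar> \<le> R i" for i using l(1) by (simp add: C_def)
  have l_dev: "\<bar>of_int i - l i / \<theta>\<bar> \<le> 8 * (\<bar>l i\<bar> / tau ^ n) + K n" for i n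
  proof (rule LIMSEQ_le)
    show "(\<lambda>k. \<bar>of_int i - y (r k) i / \<theta>\<bar>) \<longlonglongrightarrow> \<bar>of_int i - l i / \<theta>\<bar>"
      using \<theta> by (intro tendsto_intros lim) auto
    show "(\<lambda>k. 8 * (\<bar>y (r k) i\<bar> / tau ^ n) + K n) \<longlonglongrightarrow> 8 * (\<bar>l i\<bar> / tau ^ n) + K n"
      using tau_pos by (intro tendsto_intros lim) auto
    show "\<exists>N. \<forall>k\<ge>N. \<bar>of_int i - y (r k) i / \<theta>\<bar> \<le> 8 * (\<bar>y (r k) i\<bar> / tau ^ n) + K n"
      by (intro exI[of _ "m0 n"] allI impI dev order.trans[OF _ r_ge])
  qed
  have "has_rotation_number l \<theta>"
  proof (rule has_rotation_numberI)
    fix e :: real assume "0 < e"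
    \<comment> \<open>The number \<open>16 * \<theta>\<^sup>2\<close> is the product of \<theta>,
      the 8 of the density estimate and the \<open>2 * \<theta>\<close> in \<open>R\<close>.\<close>
    obtain n where n: "16 * \<theta>\<^sup>2 / e < tau ^ n" using real_arch_pow[of tau] tau_bounds by fastforce
    then have n': "16 * \<theta>\<^sup>2 / tau ^ n \<le> e" using \<open>0 < e\<close> tau_pos by (simp add: field_simps)
    have "\<bar>l i - of_int i * \<theta>\<bar> \<le> e * \<bar>of_int i\<bar> + (e * K n0 + \<theta> * K n)" for i
    proof -
      have "\<bar>l i - of_int i * \<theta>\<bar> = \<theta> * \<bar>of_int i - l i / \<theta>\<bar>"
        using \<theta> abs_mult[of \<theta> "of_int i - l i / \<theta>"] by (simp add: right_diff_distrib abs_minus_commute mult.commute)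
      also have "\<dots> \<le> \<theta> * (8 * (R i / tau ^ n) + K n)"
      proof (intro mult_left_mono)
        have "\<bar>l i\<bar> / tau ^ n \<le> R i / tau ^ n" using l_bound tau_pos by (intro divide_right_mono) auto
        then show "\<bar>of_int i - l i / \<theta>\<bar> \<le> 8 * (R i / tau ^ n) + K n" using l_dev[of i n] by linarith
      qed (use \<theta> in simp)
      also have "\<dots> = 16 * \<theta>\<^sup>2 / tau ^ n * (\<bar>of_int i\<bar> + K n0) + \<theta> * K n"
        by (simp add: R_def power2_eq_square algebra_simps)
      also have "16 * \<theta>\<^sup>2 / tau ^ n * (\<bar>of_int i\<bar> + K n0) \<le> e * (\<bar>of_int i\<bar> + K n0)"
        using n' K0 by (intro mult_right_mono) auto
      finally show ?thesis by (simp add: algebra_simps)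
    qed
    then show "\<exists>K. \<forall>i. \<bar>l i - of_int i * \<theta>\<bar> \<le> e * \<bar>of_int i\<bar> + K" by blast
  qed
  moreover have "minimal_configuration H l"
    unfolding minimal_configuration_def minimal_segment_def
  proof (intro allI impI)
    fix j k z assume "j < k" and z: "z j = l j \<and> z k = l k"
    \<comment> \<open>The ends of z are those of the limit, so they are replaced by those of the
      approximating chain to obtain a competitor there; the replacements tend to z.\<close>
    define z' where "z' n i = (if i = j \<or> i = k then y (r n) i else z i)" for n i
    \<comment> \<open>From N on, the window contains the competitor and the chain contains the
      indices j and k.\<close>
    define N where "N = nat \<lceil>(\<Sum>i\<in>{j..k}. \<bar>z i\<bar>) + R j + R k\<rceil>"
    have R0: "0 \<le> R i" for i using \<theta> K0 by (simp add: R_def)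
    show "segment_energy H l j k \<le> segment_energy H z j k"
    proof (rule LIMSEQ_le)
      show "(\<lambda>n. segment_energy H (y (r n)) j k) \<longlonglongrightarrow> segment_energy H l j k"
        by (intro segment_energy_tendsto lim)
      show "(\<lambda>n. segment_energy H (z' n) j k) \<longlonglongrightarrow> segment_energy H z j k"
      proof (rule segment_energy_tendsto)
        show "(\<lambda>n. z' n i) \<longlonglongrightarrow> z i" for i
        proof (cases "i = j \<or> i = k")
          case True
          then show ?thesis using lim[of i] z by (auto simp: z'_def)
        qed (simp add: z'_def)
      qed
      show "\<exists>N. \<forall>n\<ge>N. segment_energy H (y (r n)) j k \<le> segment_energy H (z' n) j k"
      proof (intro exI[of _ N] allI impI)
        fix n assume "N \<le> n"
        define W where "W = window (m (r n))"
        have "real n \<le> W" using window_ge[of "m (r n)"] r_ge[of n] by (simp add: W_def)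
        moreover have "(\<Sum>i\<in>{j..k}. \<bar>z i\<bar>) + R j + R k \<le> real N" unfolding N_def by linarith
        ultimately have W: "(\<Sum>i\<in>{j..k}. \<bar>z i\<bar>) + R j + R k \<le> W" using \<open>N \<le> n\<close> by linarith
        have "0 \<le> (\<Sum>i\<in>{j..k}. \<bar>z i\<bar>)" by (intro sum_nonneg) auto
        then have WR: "R j \<le> W" "R k \<le> W" using W R0[of j] R0[of k] by linarith+
        let ?c = "count_below (xs (m (r n))) 0"
        have "0 \<le> W" using window_pos by (simp add: W_def less_imp_le)
        \<comment> \<open>Applied to each half of the window: it holds enough atoms for j and k to
          be indices of the chain.\<close>
        have part: "W / (2 * \<theta>) - K n0 \<le> real (count_below (xs (m (r n))) t) - real (count_below (xs (m (r n))) s)"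
          if "t - s = W" "- W \<le> s" "t \<le> W" for s t
        proof -
          have "\<bar>real (count_below (xs (m (r n))) t) - real (count_below (xs (m (r n))) s) - (t - s) / \<theta>\<bar>
            \<le> 8 * ((t - s) / tau ^ n0) + K n0"
            using that \<open>0 \<le> W\<close> by (intro K) (auto simp: W_def m_def)
          moreover have "W / \<theta> = W / (2 * \<theta>) + W / (2 * \<theta>)" by (simp add: field_simps)
          ultimately show ?thesis using small[OF \<open>0 \<le> W\<close>] unfolding that(1) by linarith
        qed
        have idx: "\<bar>of_int i\<bar> \<le> W / (2 * \<theta>) - K n0" if "R i \<le> W" for i :: int
          using that \<theta> by (simp add: R_def field_simps)
        have "real (count_below (xs (m (r n))) 0) \<ge> \<bar>of_int j\<bar>"
          using part[of 0 "- W"] idx[OF WR(1)] \<open>0 \<le> W\<close> balanced_ends(4)[OF bal] by (simp add: W_def)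
        moreover have "real (length (xs (m (r n))) - 1) - real ?c \<ge> \<bar>of_int k\<bar>"
          using part[of W 0] idx[OF WR(2)] \<open>0 \<le> W\<close> balanced_ends(5)[OF bal] by (simp add: W_def)
        moreover have "0 < length (xs (m (r n)))" using balanced_ends(3)[OF bal] by simp
        ultimately have ends: "0 \<le> j + int ?c" "k + int ?c < int (length (xs (m (r n))))"
          by linarith+
        have bounded: "\<bar>z' n i\<bar> \<le> W" if "j \<le> i" "i \<le> k" for i
        proof -
          have "\<bar>z i\<bar> \<le> (\<Sum>i\<in>{j..k}. \<bar>z i\<bar>)" using that by (intro member_le_sum) auto
          then have "\<bar>z i\<bar> \<le> W" using W R0[of j] R0[of k] by linarith
          then show ?thesis using y_bound[of "r n" j] y_bound[of "r n" k] WR by (auto simp: z'_def)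
        qed
        show "segment_energy H (y (r n)) j k \<le> segment_energy H (z' n) j k"
          unfolding y_def
          by (rule centred_minimal[OF bal \<open>j < k\<close> ends])
             (use bounded in \<open>auto simp: z'_def y_def W_def\<close>)
      qed
    qed
  qed
  ultimately show ?thesis by blast
qed

section \<open>Equilibria on the peaks\<close>

lemma geometric_weighted_sum:
  fixes q :: real and f :: "nat \<Rightarrow> real"
  assumes q: "\<bar>q\<bar> \<le> 1/2" and f: "\<And>n. \<bar>f n\<bar> \<le> M"
  shows "\<bar>\<Sum>n. q ^ n * f n\<bar> \<le> 2 * M"
    and "(\<Sum>n. q ^ n * f n) = f 0 + q * (\<Sum>n. q ^ n * f (Suc n))"
proof -
  have sums: "(\<lambda>n. (1/2) ^ n * M) sums (2 * M)"
    using sums_mult2[OF geometric_sums[of "1/2 :: real"], of M] by simp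
  have le: "norm (q ^ n * f k) \<le> (1/2) ^ n * M" for n k
    unfolding real_norm_def abs_mult power_abs using q f[of k]
    by (intro mult_mono power_mono) auto
  have summable: "summable (\<lambda>n. q ^ n * f (k n))" for k
    by (rule summable_comparison_test'[OF sums_summable[OF sums], of 0]) (rule le)
  show "\<bar>\<Sum>n. q ^ n * f n\<bar> \<le> 2 * M"
    using norm_suminf_le[OF le sums_summable[OF sums], of "\<lambda>n. n"] sums_unique[OF sums] by simp
  show "(\<Sum>n. q ^ n * f n) = f 0 + q * (\<Sum>n. q ^ n * f (Suc n))"
    using suminf_mult[OF summable[of Suc], of q] suminf_split_head[OF summable[of "\<lambda>n. n"]]
    by (simp add: mult.assoc)
qed

text \<open>The solution is the convolution of \<open>D\<close> with \<open>q ^ \<bar>n\<bar> / (126 + 2 * q)\<close>, where \<open>q\<close> is the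
  root of \<open>q\<^sup>2 + 126 * q + 1\<close> of modulus less than 1.\<close>

lemma bounded_solution:
  fixes D :: "int \<Rightarrow> real"
  assumes D: "\<And>i. \<bar>D i\<bar> \<le> 4"
  shows "\<exists>t. (\<forall>i. 126 * t i + t (i - 1) + t (i + 1) = D i) \<and> (\<forall>i. \<bar>t i\<bar> \<le> 1/6)"
proof -
  define q :: real where "q = sqrt 3968 - 63"
  have sq: "sqrt 3968 ^ 2 = (3968 :: real)" by simp
  have "62.9 < sqrt (3968 :: real)" by (rule real_less_rsqrt) (simp add: power2_eq_square)
  moreover have "sqrt 3968 < (63 :: real)" by (rule real_less_lsqrt) (simp_all add: power2_eq_square)
  ultimately have q: "- 1/10 < q" "q < 0" by (simp_all add: q_def)
  \<comment> \<open>The other root is \<open>- 126 - q\<close>, and the product of the roots is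
    1.\<close>
  have qq: "q * (- 126 - q) = 1" using sq unfolding q_def by (simp add: power2_eq_square algebra_simps)
  have q2: "\<bar>q\<bar> \<le> 1/2" using q by simp
  define a where "a i = (\<Sum>n. q ^ n * D (i + int n))" for i
  define b where "b i = (\<Sum>n. q ^ n * D (i - int n))" for i
  have a: "a i = D i + q * a (i + 1)" for i
    using geometric_weighted_sum(2)[of q "\<lambda>n. D (i + int n)" 4] q2 D by (simp add: a_def algebra_simps)
  have b: "b i = D i + q * b (i - 1)" for i
    using geometric_weighted_sum(2)[of q "\<lambda>n. D (i - int n)" 4] q2 D by (simp add: b_def algebra_simps)
  have ab: "\<bar>a i\<bar> \<le> 8" "\<bar>b i\<bar> \<le> 8" for i
    using geometric_weighted_sum(1)[of q "\<lambda>n. D (i + int n)" 4]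
      geometric_weighted_sum(1)[of q "\<lambda>n. D (i - int n)" 4] q2 D by (simp_all add: a_def b_def)
  define c where "c = 126 + 2 * q"
  have c: "120 \<le> c" using q by (simp add: c_def)
  \<comment> \<open>The term at n = 0 occurs in both one-sided sums and is subtracted once. The size
    is at most (8 + 8 + 4) / 120 = 1/6.\<close>
  define t where "t i = (a i + b i - D i) / c" for i
  have "126 * t i + t (i - 1) + t (i + 1) = D i" for i
  proof -
    have a': "a (i + 1) = (- 126 - q) * (a i - D i)"
      using a[of i] qq by (metis add_diff_cancel_left' mult.assoc mult.commute mult_1)
    have b': "b (i - 1) = (- 126 - q) * (b i - D i)"
      using b[of i] qq by (metis add_diff_cancel_left' mult.assoc mult.commute mult_1)
    have "126 * (a i + b i - D i) + (a (i - 1) + b (i - 1) - D (i - 1)) + (a (i + 1) + b (i + 1) - D (i + 1)) = c * D i"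
      using a[of "i - 1"] b[of "i + 1"] unfolding a' b' c_def by (simp add: algebra_simps)
    moreover have "126 * t i + t (i - 1) + t (i + 1) = (126 * (a i + b i - D i)
        + (a (i - 1) + b (i - 1) - D (i - 1)) + (a (i + 1) + b (i + 1) - D (i + 1))) / c"
      by (simp add: t_def add_divide_distrib)
    ultimately show ?thesis using c by simp
  qed
  moreover have "\<bar>t i\<bar> \<le> 1/6" for i
  proof -
    have "\<bar>a i + b i - D i\<bar> \<le> 20" using ab[of i] D[of i] by linarith
    then show ?thesis using c by (simp add: t_def abs_divide divide_le_eq)
  qed
  ultimately show ?thesis by blast
qed

lemma V_peak: "\<bar>x - S i\<bar> \<le> 1/4 \<Longrightarrow> V x = 160/27 - 64 * (x - S i)\<^sup>2"
  using V_near[of x i] by (simp add: zeta_def)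

lemma V_peak_derivative:
  assumes "\<bar>x - S i\<bar> < 1/4"
  shows "(V has_real_derivative - 128 * (x - S i)) (at x)"
proof -
  have "((\<lambda>y. 160/27 - 64 * (y - S i)\<^sup>2) has_real_derivative - 128 * (x - S i)) (at x)"
    by (auto intro!: derivative_eq_intros)
  moreover have "eventually (\<lambda>y. \<bar>y - S i\<bar> < 1/4) (nhds x)"
    using assms by (intro order_tendstoD(2)[of _ "\<bar>x - S i\<bar>"]) (auto intro!: tendsto_intros filterlim_ident)
  then have "eventually (\<lambda>y. V y = 160/27 - 64 * (y - S i)\<^sup>2) (nhds x)"
    by eventually_elim (simp add: V_peak)
  ultimately show ?thesis by (metis DERIV_cong_ev)
qed

lemma exists_nonminimal_equilibrium:
  "\<exists>x. equilibrium_configuration H x \<and> has_rotation_number x \<theta> \<and> \<not> minimal_configuration H x"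
proof -
  have "\<exists>p. S p \<le> of_int i * \<theta> \<and> of_int i * \<theta> < S (p + 1)" for i :: int
    by (rule S_cover)
  then obtain p where p: "\<And>i :: int. S (p i) \<le> of_int i * \<theta>" "\<And>i. of_int i * \<theta> < S (p i + 1)"
    by metis
  define s where "s i = S (p i)" for i :: int
  have s: "s i \<le> of_int i * \<theta>" "of_int i * \<theta> \<le> s i + 2" for i
    using p[of i] S_succ[of "p i"] len_le_2[of "w (p i)"] by (simp_all add: s_def)
  define D where "D i = 2 * s i - s (i - 1) - s (i + 1)" for i
  \<comment> \<open>Linear terms drop out of the second difference, and
    \<open>s i - of_int i * \<theta>\<close> lies between -2 and 0.\<close>
  have "\<bar>D i\<bar> \<le> 4" for i
    using s[of i] s[of "i - 1"] s[of "i + 1"] by (simp add: D_def algebra_simps abs_le_iff)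
  then obtain t where t: "\<And>i. 126 * t i + t (i - 1) + t (i + 1) = D i" "\<And>i. \<bar>t i\<bar> \<le> 1/6"
    using bounded_solution[of D] by blast
  define x where "x i = s i + t i" for i
  \<comment> \<open>The slope of \<open>V\<close> near the peak is \<open>- 128 * t i\<close>; the
    elastic force contributes \<open>2 * t i\<close>, whence the coefficient 126.\<close>
  have force: "2 * x i - x (i - 1) - x (i + 1) = 128 * t i" for i
    using t(1)[of i] by (simp add: x_def D_def)
  have "equilibrium_configuration H x"
    unfolding equilibrium_configuration_def
  proof (intro allI exI conjI)
    fix i
    show "((\<lambda>\<eta>. H (x (i - 1)) \<eta>) has_real_derivative (x i - x (i - 1))) (at (x i))"
      unfolding H_def by (auto intro!: derivative_eq_intros)
    have "(V has_real_derivative - 128 * t i) (at (x i))"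
      using V_peak_derivative[of "x i" "p i"] t(2)[of i] by (simp add: x_def s_def)
    then show "((\<lambda>\<xi>. H \<xi> (x (i + 1))) has_real_derivative (x i - x (i + 1) + - 128 * t i)) (at (x i))"
      unfolding H_def by (auto intro!: derivative_eq_intros)
    show "x i - x (i - 1) + (x i - x (i + 1) + - 128 * t i) = 0"
      using force[of i] by simp
  qed
  moreover have "has_rotation_number x \<theta>"
  proof (rule has_rotation_numberI)
    fix e :: real assume "0 < e"
    have "\<bar>x i - of_int i * \<theta>\<bar> \<le> e * \<bar>of_int i\<bar> + 3" for i
    proof -
      have "\<bar>x i - of_int i * \<theta>\<bar> \<le> 3" using s[of i] t(2)[of i] unfolding x_def by linarith
      moreover have "0 \<le> e * \<bar>of_int i\<bar>" using \<open>0 < e\<close> by simp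
      ultimately show ?thesis by linarith
    qed
    then show "\<exists>K. \<forall>i. \<bar>x i - of_int i * \<theta>\<bar> \<le> e * \<bar>of_int i\<bar> + K" by blast
  qed
  moreover have "\<not> minimal_configuration H x"
  proof
    assume "minimal_configuration H x"
    then have min: "minimal_segment H x (-1) 1" by (simp add: minimal_configuration_def)
    \<comment> \<open>By stationarity the linear terms cancel, so a shift by e of one atom changes
      the energy by \<open>e\<^sup>2 - 64 * e\<^sup>2\<close>, as long as the atom stays within 1/4
      of the peak; 1/6 + 1/100 is below 1/4.\<close>
    define y where "y = x(0 := x 0 + 1/100)"
    have seg: "segment_energy H z (-1) 1 = H (z (-1)) (z 0) + H (z 0) (z 1)" for z
    proof -
      have "{-1..<1} = {-1, 0 :: int}" by auto
      then show ?thesis by (simp add: segment_energy_def)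
    qed
    have "segment_energy H x (-1) 1 \<le> segment_energy H y (-1) 1"
      using min by (simp add: minimal_segment_def y_def)
    then have "H (x (-1)) (x 0) + H (x 0) (x 1) \<le> H (x (-1)) (x 0 + 1/100) + H (x 0 + 1/100) (x 1)"
      by (simp add: seg y_def)
    moreover have "\<bar>t 0\<bar> \<le> 1/4" "\<bar>t 0 + 1/100\<bar> \<le> 1/4" using t(2)[of 0] by linarith+
    then have "V (x 0) = 160/27 - 64 * (t 0)\<^sup>2" "V (x 0 + 1/100) = 160/27 - 64 * (t 0 + 1/100)\<^sup>2"
      using V_peak[of "x 0" "p 0"] V_peak[of "x 0 + 1/100" "p 0"] by (simp_all add: x_def s_def algebra_simps)
    ultimately show False using force[of 0] by (simp add: H_def power2_eq_square field_simps)
  qed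
  ultimately show ?thesis by blast
qed

theorem theorem1p1:
  fixes \<theta> :: real
  assumes "\<theta> = (3 * tau + 1) / 2"
  shows "(\<exists>x. minimal_configuration H x \<and> has_rotation_number x \<theta>) \<and>
         (\<exists>x. equilibrium_configuration H x \<and> has_rotation_number x \<theta> \<and>
              \<not> minimal_configuration H x)"
proof
  have "1 \<le> \<theta>" "\<theta> \<le> 3"
    using tau_bounds unfolding assms by (simp_all add: field_simps)
  then show "\<exists>x. minimal_configuration H x \<and> has_rotation_number x \<theta>"
    by (rule exists_minimal_configuration)
qed (rule exists_nonminimal_equilibrium)

end
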